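(* Let $\phi:H_{\bar0}\to W_{\bar1}$ be a derivation (i.e. $\phi$ is linear and $\phi([x,y])=[\phi(x),y]+[x,\phi(y)]$ for all $x,y\in H_{\bar0}$) with $\phi(\mathcal J)=0$. Then: (1) if $n$ is even, $\phi=0$; (2) if $n$ is odd, then $\phi(D_H(x^{(\pi)}))=\mu D_H(x^\omega)$ for some $\mu\in\mathbb F$. Conversely, when $n$ is odd, for every $\mu\in\mathbb F$ the linear map $\Gamma_\mu:H_{\bar0}\to W_{\bar1}$ with $\Gamma_\mu(\mathcal J)=0$ and $\Gamma_\mu(D_H(x^{(\pi)}))=\mu D_H(x^\omega)$ is a derivation from $H_{\bar0}$ into $W_{\bar1}$.
   Context: Let $\mathbb F$ be an algebraically closed field of characteristic $p>3$. Fix positive integers $m=2r$ and $n$; write $n=2s$ if $n$ is even and $n=2s+1$ if $n$ is odd. Put $I_0=\{1,\dots,m\}$, $I_1=\{m+1,\dots,m+n\}$, $I=I_0\cup I_1$. Fix positive integers $t_1,\dots,t_m$, put $\pi=(\pi_1,\dots,\pi_m)$ with $\pi_i=p^{t_i}-1$, and $\mathbb A=\{\alpha\in\mathbb N_0^m:\alpha_i\le\pi_i\ \forall i\}$; $\varepsilon_i$ is the $i$-th unit vector and $|\alpha|=\sum\alpha_i$. Let $\mathbb B$ be the set of strictly increasing sequences $u=\langle i_1<\dots<i_k\rangle$ of elements of $I_1$ (including the empty one $\emptyset$), $|u|=k$, $\mathbb B^0=\{u\in\mathbb B:|u|\text{ even}\}$, $\omega=\langle m+1,\dots,m+n\rangle$.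 Let $\mathcal O=\mathcal O(m,n;\underline t)$ be the supercommutative associative superalgebra with basis $x^{(\alpha)}x^u$ ($\alpha\in\mathbb A,u\in\mathbb B$), where $x^{(\alpha)}x^{(\beta)}=\binom{\alpha+\beta}{\alpha}x^{(\alpha+\beta)}$, $x^{(\alpha)}$ even, $x_{m+1},\dots,x_{m+n}$ odd and pairwise anticommuting, $x^u=x_{i_1}\cdots x_{i_k}$, $x^\emptyset=1$, $x_i:=x^{(\varepsilon_i)}$ for $i\in I_0$. $\mathcal O$ is $\mathbb Z$-graded by $\mathrm{zd}(x^{(\alpha)}x^u)=|\alpha|+|u|$. For $i\in I$ let $\partial_i$ be the superderivation of $\mathcal O$ with $\partial_i(x^{(\alpha)})=x^{(\alpha-\varepsilon_i)}$ for $i\in I_0$ and $\partial_i(x_k)=\delta_{ik}$ for $i\in I_1$; its parity is $\mu(i)=\bar0$ for $i\in I_0$, $\mu(i)=\bar1$ for $i\in I_1$. $W=\{\sum_{i\in I}f_i\partial_i: f_i\in\mathcal O\}$ is the Lie superalgebra with bracket $[f\partial_i,g\partial_j]=f\partial_i(g)\partial_j-(-1)^{p(f\partial_i)p(g\partial_j)}g\partial_j(f)\partial_i$, $\mathbb Z$-graded by $\mathrm{zd}(f\partial_j)=\mathrm{zd}(f)-1$, with even and odd parts $W_{\bar 0},W_{\bar1}$. Define $i'=i+r$ ($1\le i\le r$), $i'=i-r$ ($r<i\le m$), $i'=i+s$ ($m<i\le m+s$), $i'=i-s$ ($m+s<i\le m+2s$), and $i'=i$ otherwise; $\tau(i)=1$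 for $1\le i\le r$, $\tau(i)=-1$ for $r<i\le m$, $\tau(i)=1$ for $i\in I_1$. For $f\in\mathcal O$ put $D_H(f)=\sum_{i\in I}\tau(i)(-1)^{\mu(i)p(f)}\partial_i(f)\partial_{i'}$. Let $H_{\bar0}=\mathrm{span}_{\mathbb F}\{D_H(x^{(\alpha)}x^u):\alpha\in\mathbb A,u\in\mathbb B^0,(\alpha,u)\ne(\pi,\omega)\}$, a $\mathbb Z$-graded subalgebra of $W_{\bar0}$ with $\mathrm{zd}(D_H(f))=\mathrm{zd}(f)-2$, and $\mathcal J=\mathrm{span}_{\mathbb F}\{D_H(x^{(\alpha)}x^u):\alpha\in\mathbb A,u\in\mathbb B^0,(\alpha,u)\ne(\pi,\omega),(\alpha,u)\ne(\pi,\emptyset)\}$, an ideal of $H_{\bar0}$ with $H_{\bar0}=\mathcal J\oplus\mathbb F D_H(x^{(\pi)})$. $W_{\bar1}$ is an $H_{\bar0}$-module via the bracket of $W$. *)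

theory Defs
  imports "HOL-Computational_Algebra.Polynomial"
begin

text \<open>
Parameters used throughout: p (the characteristic), r (with m = 2r), n, and
t :: nat => nat (the heights t_1..t_m; values outside 1..m are irrelevant).
Basis monomials x^(alpha) x^u of O are indexed by pairs (alpha, u) with
alpha :: nat => nat (zero outside 1..m) and u a subset of I_1 (a strictly
increasing sequence is identified with its set of entries).
An element of O is a coefficient function on basis indices; an element of W
is a function from derivation indices i (coefficient of the partial derivative d_i)
to elements of O.
\<close>

type_synonym bidx = "(nat \<Rightarrow> nat) \<times> nat set"
type_synonym 'a Oel = "bidx \<Rightarrow> 'a"
type_synonym 'a Wel = "nat \<Rightarrow> bidx \<Rightarrow> 'a"

definition I0 :: "nat \<Rightarrow> nat set" where "I0 r = {1..2*r}"
definition I1 :: "nat \<Rightarrow> nat \<Rightarrow> nat set" where "I1 r n = {2*r+1..2*r+n}"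
definition Iall :: "nat \<Rightarrow> nat \<Rightarrow> nat set" where "Iall r n = I0 r \<union> I1 r n"

definition piv :: "nat \<Rightarrow> nat \<Rightarrow> (nat \<Rightarrow> nat) \<Rightarrow> nat \<Rightarrow> nat" where
  "piv p r t i = (if i \<in> I0 r then p ^ t i - 1 else 0)"

definition Aset :: "nat \<Rightarrow> nat \<Rightarrow> (nat \<Rightarrow> nat) \<Rightarrow> (nat \<Rightarrow> nat) set" where
  "Aset p r t = {\<alpha>. \<forall>i. \<alpha> i \<le> piv p r t i}"

definition Bset :: "nat \<Rightarrow> nat \<Rightarrow> nat set set" where "Bset r n = Pow (I1 r n)"
definition B0set :: "nat \<Rightarrow> nat \<Rightarrow> nat set set" where
  "B0set r n = {u \<in> Bset r n. even (card u)}"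
definition omega :: "nat \<Rightarrow> nat \<Rightarrow> nat set" where "omega r n = I1 r n"

definition Basis :: "nat \<Rightarrow> nat \<Rightarrow> nat \<Rightarrow> (nat \<Rightarrow> nat) \<Rightarrow> bidx set" where
  "Basis p r n t = Aset p r t \<times> Bset r n"

definition muI :: "nat \<Rightarrow> nat \<Rightarrow> nat \<Rightarrow> nat" where
  "muI r n i = (if i \<in> I1 r n then 1 else 0)"

definition primeI :: "nat \<Rightarrow> nat \<Rightarrow> nat \<Rightarrow> nat" where
  "primeI r n i = (let s = n div 2 in
     if 1 \<le> i \<and> i \<le> r then i + r
     else if r < i \<and> i \<le> 2*r then i - r
     else if 2*r < i \<and> i \<le> 2*r + s then i + s
     else if 2*r + s < i \<and> i \<le> 2*r + 2*s then i - s
     else i)"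

definition tauI :: "nat \<Rightarrow> nat \<Rightarrow> 'a::field" where
  "tauI r i = (if 1 \<le> i \<and> i \<le> r then 1 else if r < i \<and> i \<le> 2*r then -1 else 1)"

definition mono :: "bidx \<Rightarrow> 'a::field Oel" where
  "mono a = (\<lambda>b. if b = a then 1 else 0)"

text \<open>sign arising from x^u x^v = sign * x^(u union v) for disjoint u, v\<close>
definition sgn_uv :: "nat set \<Rightarrow> nat set \<Rightarrow> 'a::field" where
  "sgn_uv u v = (-1) ^ card {(i, j). i \<in> u \<and> j \<in> v \<and> j < i}"

text \<open>product of two basis monomials:
  (x^(alpha) x^u)(x^(beta) x^v) = binom(alpha+beta, alpha) x^(alpha+beta) x^u x^v,
  where x^(gamma) = 0 for gamma not in A\<close>
definition mult_basis :: "nat \<Rightarrow> nat \<Rightarrow> (nat \<Rightarrow> nat) \<Rightarrow> bidx \<Rightarrow> bidx \<Rightarrow> 'a::field Oel" where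
  "mult_basis p r t a b =
     (let \<alpha> = fst a; u = snd a; \<beta> = fst b; v = snd b; \<gamma> = (\<lambda>i. \<alpha> i + \<beta> i) in
      if u \<inter> v = {} \<and> \<gamma> \<in> Aset p r t then
        (\<lambda>c. if c = (\<gamma>, u \<union> v)
              then of_nat (\<Prod>i\<in>I0 r. (\<gamma> i choose \<alpha> i)) * sgn_uv u v else 0)
      else (\<lambda>c. 0))"

definition Omult :: "nat \<Rightarrow> nat \<Rightarrow> nat \<Rightarrow> (nat \<Rightarrow> nat) \<Rightarrow> 'a::field Oel \<Rightarrow> 'a Oel \<Rightarrow> 'a Oel" where
  "Omult p r n t f g = (\<lambda>c. \<Sum>a\<in>Basis p r n t. \<Sum>b\<in>Basis p r n t.
      f a * g b * mult_basis p r t a b c)"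

definition dpart_basis :: "nat \<Rightarrow> nat \<Rightarrow> nat \<Rightarrow> bidx \<Rightarrow> 'a::field Oel" where
  "dpart_basis r n i a =
     (let \<alpha> = fst a; u = snd a in
      if i \<in> I0 r then (if 1 \<le> \<alpha> i then mono (\<alpha>(i := \<alpha> i - 1), u) else (\<lambda>c. 0))
      else if i \<in> I1 r n then
        (if i \<in> u then (\<lambda>c. (-1) ^ card {j \<in> u. j < i} * mono (\<alpha>, u - {i}) c)
         else (\<lambda>c. 0))
      else (\<lambda>c. 0))"

definition dpart :: "nat \<Rightarrow> nat \<Rightarrow> nat \<Rightarrow> (nat \<Rightarrow> nat) \<Rightarrow> nat \<Rightarrow> 'a::field Oel \<Rightarrow> 'a Oel" where
  "dpart p r n t i f = (\<lambda>c. \<Sum>a\<in>Basis p r n t. f a * dpart_basis r n i a c)"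

definition parW :: "nat \<Rightarrow> nat \<Rightarrow> bidx \<Rightarrow> nat \<Rightarrow> nat" where
  "parW r n a i = card (snd a) + muI r n i"

text \<open>[f d_i, g d_j] = f d_i(g) d_j - (-1)^(p(f d_i) p(g d_j)) g d_j(f) d_i
  for basis monomials f = x^a, g = x^b\<close>
definition bracket_basis :: "nat \<Rightarrow> nat \<Rightarrow> nat \<Rightarrow> (nat \<Rightarrow> nat) \<Rightarrow> bidx \<Rightarrow> nat \<Rightarrow> bidx \<Rightarrow> nat \<Rightarrow> 'a::field Wel" where
  "bracket_basis p r n t a i b j = (\<lambda>k c.
      (if k = j then Omult p r n t (mono a) (dpart p r n t i (mono b)) c else 0)
    - (-1) ^ (parW r n a i * parW r n b j) *
      (if k = i then Omult p r n t (mono b) (dpart p r n t j (mono a)) c else 0))"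

definition brW :: "nat \<Rightarrow> nat \<Rightarrow> nat \<Rightarrow> (nat \<Rightarrow> nat) \<Rightarrow> 'a::field Wel \<Rightarrow> 'a Wel \<Rightarrow> 'a Wel" where
  "brW p r n t D E = (\<lambda>k c. \<Sum>i\<in>Iall r n. \<Sum>j\<in>Iall r n. \<Sum>a\<in>Basis p r n t. \<Sum>b\<in>Basis p r n t.
      D i a * E j b * bracket_basis p r n t a i b j k c)"

definition W1 :: "nat \<Rightarrow> nat \<Rightarrow> nat \<Rightarrow> (nat \<Rightarrow> nat) \<Rightarrow> 'a::field Wel set" where
  "W1 p r n t = {D. \<forall>k c. D k c \<noteq> 0 \<longrightarrow>
       k \<in> Iall r n \<and> c \<in> Basis p r n t \<and> odd (card (snd c) + muI r n k)}"

text \<open>D_H(f) = sum_i tau(i) (-1)^(mu(i) p(f)) d_i(f) d_(i') for f homogeneous of parity pf\<close>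
definition DH :: "nat \<Rightarrow> nat \<Rightarrow> nat \<Rightarrow> (nat \<Rightarrow> nat) \<Rightarrow> nat \<Rightarrow> 'a::field Oel \<Rightarrow> 'a Wel" where
  "DH p r n t pf f = (\<lambda>k c. \<Sum>i\<in>Iall r n.
      if primeI r n i = k then tauI r i * (-1) ^ (muI r n i * pf) * dpart p r n t i f c else 0)"

definition DHm :: "nat \<Rightarrow> nat \<Rightarrow> nat \<Rightarrow> (nat \<Rightarrow> nat) \<Rightarrow> bidx \<Rightarrow> 'a::field Wel" where
  "DHm p r n t a = DH p r n t (card (snd a)) (mono a)"

definition genH :: "nat \<Rightarrow> nat \<Rightarrow> nat \<Rightarrow> (nat \<Rightarrow> nat) \<Rightarrow> bidx set" where
  "genH p r n t = (Aset p r t \<times> B0set r n) - {(piv p r t, omega r n)}"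

definition genJ :: "nat \<Rightarrow> nat \<Rightarrow> nat \<Rightarrow> (nat \<Rightarrow> nat) \<Rightarrow> bidx set" where
  "genJ p r n t = genH p r n t - {(piv p r t, {})}"

definition H0 :: "nat \<Rightarrow> nat \<Rightarrow> nat \<Rightarrow> (nat \<Rightarrow> nat) \<Rightarrow> 'a::field Wel set" where
  "H0 p r n t = {(\<lambda>k c. \<Sum>a\<in>genH p r n t. lam a * DHm p r n t a k c) | lam. True}"

definition Jid :: "nat \<Rightarrow> nat \<Rightarrow> nat \<Rightarrow> (nat \<Rightarrow> nat) \<Rightarrow> 'a::field Wel set" where
  "Jid p r n t = {(\<lambda>k c. \<Sum>a\<in>genJ p r n t. lam a * DHm p r n t a k c) | lam. True}"

definition is_derivation :: "nat \<Rightarrow> nat \<Rightarrow> nat \<Rightarrow> (nat \<Rightarrow> nat) \<Rightarrow> ('a::field Wel \<Rightarrow> 'a Wel) \<Rightarrow> bool" where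
  "is_derivation p r n t \<phi> \<longleftrightarrow>
     (\<forall>x\<in>H0 p r n t. \<phi> x \<in> W1 p r n t) \<and>
     (\<forall>x\<in>H0 p r n t. \<forall>y\<in>H0 p r n t. \<phi> (\<lambda>k c. x k c + y k c) = (\<lambda>k c. \<phi> x k c + \<phi> y k c)) \<and>
     (\<forall>x\<in>H0 p r n t. \<forall>s. \<phi> (\<lambda>k c. s * x k c) = (\<lambda>k c. s * \<phi> x k c)) \<and>
     (\<forall>x\<in>H0 p r n t. \<forall>y\<in>H0 p r n t.
        \<phi> (brW p r n t x y) = (\<lambda>k c. brW p r n t (\<phi> x) y k c + brW p r n t x (\<phi> y) k c))"

end

theory Submission
  imports Defs
begin

text \<open>
Since \<open>\<phi>\<close> vanishes on the ideal \<open>J\<close>, applying it to \<open>[x, D\<^sub>H(x\<^sup>\<pi>)]\<close>, which lies in \<open>J\<close>, shows that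
\<open>E = \<phi>(D\<^sub>H(x\<^sup>\<pi>))\<close> centralises \<open>J\<close>. Bracketing with \<open>D\<^sub>H(x\<^sub>i)\<close> and \<open>D\<^sub>H(x\<^sub>i\<^sup>2)\<close> for even \<open>i\<close> makes \<open>E\<close>
a superderivation of the exterior algebra; bracketing with \<open>D\<^sub>H(x\<^sub>1 x\<^sub>a x\<^sub>b)\<close> gives \<open>E(x\<^sub>a x\<^sub>b) = 0\<close>, which
forces the coefficients of \<open>E\<close> into the two top degrees; torus weights and the rotations
\<open>D\<^sub>H(x\<^sub>c x\<^sub>z)\<close>, where \<open>z = m + n\<close>, leave nothing for even \<open>n\<close> and only the multiples of \<open>D\<^sub>H(x\<^sup>\<omega>)\<close> for odd \<open>n\<close>.
Conversely, the bracket of two elements of \<open>H\<close> is \<open>D\<^sub>H\<close> of a Poisson bracket, and the terms of a Poisson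
bracket with even, respectively odd, index sum up to total derivatives. Hence \<open>x\<^sup>\<pi> x\<^sup>\<omega>\<close> does not occur
in it; neither does \<open>x\<^sup>\<pi>\<close>, to which the odd indices cannot contribute by parity. The Poisson bracket
with \<open>x\<^sup>\<omega>\<close> vanishes since \<open>x\<^sup>\<omega>\<close> is killed by all odd elements.
\<close>

section \<open>Signs, finiteness and coordinate formulas\<close>

text \<open>The sign of moving x_i to its place in x^u, and also the sign of d_i on x^u. As a
  product over u it is multiplicative under insertion and disjoint union.\<close>

definition ins_sgn :: "nat \<Rightarrow> nat set \<Rightarrow> 'a::field" where
  "ins_sgn i u = (\<Prod>j\<in>u. if j < i then -1 else 1)"

lemma ins_sgn_empty [simp]: "ins_sgn i {} = 1"
  by (simp add: ins_sgn_def)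

lemma ins_sgn_insert:
  "finite u \<Longrightarrow> j \<notin> u \<Longrightarrow> ins_sgn i (insert j u) = (if j < i then -1 else 1) * ins_sgn i u"
  by (simp add: ins_sgn_def)

lemma ins_sgn_insert_self: "finite u \<Longrightarrow> ins_sgn i (insert i u) = ins_sgn i u"
  by (cases "i \<in> u") (simp_all add: ins_sgn_insert insert_absorb)

lemma ins_sgn_union:
  "finite u \<Longrightarrow> finite v \<Longrightarrow> u \<inter> v = {} \<Longrightarrow> ins_sgn i (u \<union> v) = ins_sgn i u * ins_sgn i v"
  by (simp add: ins_sgn_def prod.union_disjoint)

lemma ins_sgn_square [simp]: "ins_sgn i u * ins_sgn i u = 1"
  unfolding ins_sgn_def prod.distrib [symmetric] by (rule prod.neutral) auto

lemma ins_sgn_square_left [simp]: "ins_sgn i u * (ins_sgn i u * x) = x"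
  by (simp add: mult.assoc [symmetric])

lemma ins_sgn_nonzero [simp]: "ins_sgn i u \<noteq> 0"
  using ins_sgn_square [of i u] by (metis mult_zero_left zero_neq_one)

lemma ins_sgn_card:
  assumes "finite u" shows "(-1) ^ card {j \<in> u. j < i} = ins_sgn i u"
  using assms by (simp add: ins_sgn_def prod.inter_filter [symmetric])

text \<open>The inversions between u and v are counted row by row, one row for each i in u.\<close>

lemma sgn_uv_prod:
  assumes "finite u" "finite v"
  shows "sgn_uv u v = (\<Prod>i\<in>u. ins_sgn i v)"
proof -
  have "{(i, j). i \<in> u \<and> j \<in> v \<and> j < i} = (SIGMA i:u. {j \<in> v. j < i})" by auto
  then have "card {(i, j). i \<in> u \<and> j \<in> v \<and> j < i} = (\<Sum>i\<in>u. card {j \<in> v. j < i})"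
    using assms by simp
  then show ?thesis using assms by (simp add: sgn_uv_def power_sum ins_sgn_card)
qed

lemma sgn_uv_insert_left:
  "finite u \<Longrightarrow> finite v \<Longrightarrow> i \<notin> u \<Longrightarrow> sgn_uv (insert i u) v = ins_sgn i v * sgn_uv u v"
  by (simp add: sgn_uv_prod)

text \<open>Every k in u lies on exactly one side of i, so counting the elements above i instead of
  those below costs a factor -1 per element.\<close>

lemma prod_ins_sgn_singleton:
  assumes "finite u" "i \<notin> u"
  shows "(\<Prod>k\<in>u. if i < k then -1 else 1) = (-1) ^ card u * (ins_sgn i u :: 'a::field)"
proof -
  have "(\<Prod>k\<in>u. if i < k then -1 else 1) = (\<Prod>k\<in>u. (-1) * (if k < i then -1 else 1 :: 'a))"
    using assms by (intro prod.cong) (auto simp: not_less le_less)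
  also have "\<dots> = (-1) ^ card u * ins_sgn i u"
    unfolding prod.distrib ins_sgn_def by simp
  finally show ?thesis .
qed

lemma sgn_uv_insert_right:
  assumes "finite u" "finite v" "i \<notin> u" "i \<notin> v"
  shows "sgn_uv u (insert i v) = (-1) ^ card u * ins_sgn i u * (sgn_uv u v :: 'a::field)"
proof -
  have "sgn_uv u (insert i v) = (\<Prod>k\<in>u. (if i < k then -1 else 1) * (ins_sgn k v :: 'a))"
    using assms by (simp add: sgn_uv_prod ins_sgn_insert)
  then show ?thesis using assms by (simp add: prod.distrib sgn_uv_prod prod_ins_sgn_singleton)
qed

lemma sgn_uv_empty [simp]: "sgn_uv {} v = 1" "sgn_uv u {} = 1"
  by (simp_all add: sgn_uv_def)

lemma sgn_uv_singleton_left: "finite v \<Longrightarrow> sgn_uv {i} v = ins_sgn i v"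
  using sgn_uv_insert_left [of "{}" v i] by simp

text \<open>Each x_i removed from the left factor contributes \<open>ins_sgn i v\<close> on one side
  and \<open>(-1) ^ card v * ins_sgn i v\<close> on the other.\<close>

lemma sgn_uv_commute:
  assumes "finite u" "finite v" "u \<inter> v = {}"
  shows "sgn_uv u v = (-1) ^ (card u * card v) * (sgn_uv v u :: 'a::field)"
  using assms
proof (induction u rule: finite_induct)
  case (insert i u)
  then show ?case
    by (simp add: sgn_uv_insert_left sgn_uv_insert_right power_add algebra_simps)
qed simp

text \<open>Absorption gives k * (p^e choose k) = p^e * (p^e - 1 choose k - 1). If p did not divide
  the binomial, then p^e would divide the smaller positive number k.\<close>

lemma prime_dvd_choose_prime_power:
  fixes p :: nat
  assumes "prime p" "0 < k" "k < p ^ e"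
  shows "p dvd (p ^ e choose k)"
proof (rule ccontr)
  assume "\<not> p dvd (p ^ e choose k)"
  then have "coprime (p ^ e) (p ^ e choose k)"
    using assms(1) by (simp add: prime_imp_coprime)
  moreover have "k * (p ^ e choose k) = p ^ e * ((p ^ e - 1) choose (k - 1))"
    using assms(2,3) times_binomial_minus1_eq [of k "p ^ e"] by simp
  then have "p ^ e dvd k * (p ^ e choose k)" by simp
  ultimately have "p ^ e dvd k" by (simp add: coprime_dvd_mult_left_iff)
  with assms show False by (simp add: nat_dvd_not_less)
qed

section \<open>Finiteness of the monomial basis and truncation of exponents\<close>

lemma finite_Aset [simp]: "finite (Aset p r t)"
proof -
  let ?S = "\<Union>i\<in>I0 r. {..piv p r t i}"
  have "Aset p r t \<subseteq> {f. \<forall>i. (i \<in> I0 r \<longrightarrow> f i \<in> ?S) \<and> (i \<notin> I0 r \<longrightarrow> f i = 0)}"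
  proof (clarsimp, intro conjI allI impI)
    fix f i assume f: "f \<in> Aset p r t"
    then have *: "f i \<le> piv p r t i" by (simp add: Aset_def)
    { assume "i \<in> I0 r" then show "\<exists>x\<in>I0 r. f i \<le> piv p r t x" using * by blast }
    { assume "i \<notin> I0 r" then show "f i = 0" using * by (simp add: piv_def) }
  qed
  moreover have "finite ?S" by (simp add: I0_def)
  ultimately show ?thesis
    using finite_set_of_finite_funs [of "I0 r" ?S 0] finite_subset by (fastforce simp: I0_def)
qed

lemma finite_I1 [simp]: "finite (I1 r n)" and finite_I0 [simp]: "finite (I0 r)"
  and finite_Iall [simp]: "finite (Iall r n)"
  by (simp_all add: I1_def I0_def Iall_def)

lemma finite_Basis [simp]: "finite (Basis p r n t)"
  by (simp add: Basis_def Bset_def)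

lemma Basis_iff: "(\<alpha>, u) \<in> Basis p r n t \<longleftrightarrow> \<alpha> \<in> Aset p r t \<and> u \<subseteq> I1 r n"
  by (auto simp: Basis_def Bset_def)

lemma finite_Basis_snd: "(\<alpha>, u) \<in> Basis p r n t \<Longrightarrow> finite u"
  by (auto simp: Basis_iff intro: finite_subset)

lemma I0_I1_disjoint: "i \<in> I0 r \<Longrightarrow> i \<notin> I1 r n" "i \<in> I1 r n \<Longrightarrow> i \<notin> I0 r"
  by (auto simp: I0_def I1_def)

lemma Aset_downward: "\<alpha> \<in> Aset p r t \<Longrightarrow> (\<And>i. \<beta> i \<le> \<alpha> i) \<Longrightarrow> \<beta> \<in> Aset p r t"
  unfolding Aset_def by (auto intro: order_trans)

lemma Aset_upd_Suc: "\<gamma>(i := Suc (\<gamma> i)) \<in> Aset p r t \<Longrightarrow> \<gamma> \<in> Aset p r t"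
  by (erule Aset_downward) auto

lemma Aset_outside: "\<alpha> \<in> Aset p r t \<Longrightarrow> i \<notin> I0 r \<Longrightarrow> \<alpha> i = 0"
  by (auto simp: Aset_def piv_def dest: spec [of _ i])

section \<open>Coefficients of derivatives and products\<close>

lemma dpart_I0:
  assumes "i \<in> I0 r"
  shows "dpart p r n t i f (\<gamma>, v) =
    (if (\<gamma>(i := Suc (\<gamma> i)), v) \<in> Basis p r n t then f (\<gamma>(i := Suc (\<gamma> i)), v) else 0)"
proof -
  \<comment> \<open>Divided powers differentiate without a scalar factor, so only the monomial with
    the exponent at i raised by one contributes to the coefficient at
    \<open>(\<gamma>, v)\<close>.\<close>
  have *: "f a * dpart_basis r n i a (\<gamma>, v) = (if a = (\<gamma>(i := Suc (\<gamma> i)), v) then f a else 0)" for a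
  proof (cases a)
    case (Pair \<alpha> u)
    have "1 \<le> \<alpha> i \<and> \<gamma> = \<alpha>(i := \<alpha> i - 1) \<longleftrightarrow> \<alpha> = \<gamma>(i := Suc (\<gamma> i))"
      by (auto simp: fun_eq_iff)
    then show ?thesis using assms Pair by (auto simp: dpart_basis_def mono_def)
  qed
  show ?thesis unfolding dpart_def * by simp
qed

lemma dpart_I1:
  assumes "i \<in> I1 r n"
  shows "dpart p r n t i f (\<gamma>, v) =
    (if i \<notin> v \<and> (\<gamma>, insert i v) \<in> Basis p r n t then ins_sgn i v * f (\<gamma>, insert i v) else 0)"
proof -
  have *: "f a * dpart_basis r n i a (\<gamma>, v) =
      (if a = (\<gamma>, insert i v) then if i \<notin> v then ins_sgn i v * f a else 0 else 0)"
    if "a \<in> Basis p r n t" for a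
  proof (cases a)
    case (Pair \<alpha> u)
    have fin: "finite u" using that Pair finite_Basis_snd by blast
    have "dpart_basis r n i a (\<gamma>, v) =
        (if i \<in> u then ins_sgn i u * (if \<gamma> = \<alpha> \<and> v = u - {i} then 1 else 0) else 0)"
      using assms Pair I0_I1_disjoint(2) [OF assms] fin
      by (simp add: dpart_basis_def mono_def ins_sgn_card)
    also have "\<dots> = (if a = (\<gamma>, insert i v) \<and> i \<notin> v then ins_sgn i v else 0)"
      using fin Pair ins_sgn_insert_self [of "u - {i}" i] by (auto simp: ins_sgn_insert_self insert_absorb)
    finally have eq: "dpart_basis r n i a (\<gamma>, v) =
        (if a = (\<gamma>, insert i v) \<and> i \<notin> v then ins_sgn i v else 0)" .
    show ?thesis unfolding eq by auto
  qed
  show ?thesis unfolding dpart_def by (simp add: * cong: sum.cong)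
qed

lemma dpart_outside_index: "i \<notin> Iall r n \<Longrightarrow> dpart p r n t i f = (\<lambda>c. 0)"
  by (rule ext) (simp add: dpart_def dpart_basis_def Iall_def Let_def)

lemma dpart_outside_Basis: "c \<notin> Basis p r n t \<Longrightarrow> dpart p r n t i f c = 0"
  by (cases c; cases "i \<in> Iall r n")
    (auto simp: Iall_def dpart_I0 dpart_I1 dpart_outside_index Basis_iff dest: Aset_upd_Suc
      split: if_splits)

lemma Omult_expand:
  "Omult p r n t f g c =
    (\<Sum>a\<in>Basis p r n t. \<Sum>b\<in>Basis p r n t. f a * g b * mult_basis p r t a b c)"
  by (simp add: Omult_def)

lemma mult_basis_eq:
  "mult_basis p r t (\<alpha>, u) (\<beta>, v) c =
    (if u \<inter> v = {} \<and> (\<lambda>i. \<alpha> i + \<beta> i) \<in> Aset p r t \<and> c = (\<lambda>i. \<alpha> i + \<beta> i, u \<union> v)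
     then of_nat (\<Prod>i\<in>I0 r. (\<alpha> i + \<beta> i choose \<alpha> i)) * sgn_uv u v else 0)"
  by (auto simp: mult_basis_def Let_def)

lemma Omult_outside_Basis: "c \<notin> Basis p r n t \<Longrightarrow> Omult p r n t f g c = 0"
  unfolding Omult_expand
  by (intro sum.neutral ballI) (auto simp: mult_basis_eq Basis_iff split: if_splits)

lemma sum_mono_mult:
  assumes "finite S" "a \<in> S"
  shows "(\<Sum>x\<in>S. mono a x * h x) = h a"
proof -
  have "(\<Sum>x\<in>S. mono a x * h x) = (\<Sum>x\<in>S. if x = a then h x else 0)"
    by (intro sum.cong) (auto simp: mono_def)
  then show ?thesis using assms by simp
qed

lemma Omult_mono:
  assumes "a \<in> Basis p r n t" "b \<in> Basis p r n t"
  shows "Omult p r n t (mono a) (mono b) c = mult_basis p r t a b c"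
proof -
  have "Omult p r n t (mono a) (mono b) c = (\<Sum>x\<in>Basis p r n t. mono a x *
     (\<Sum>y\<in>Basis p r n t. mono b y * mult_basis p r t x y c))"
    by (simp add: Omult_expand sum_distrib_left mult.assoc)
  then show ?thesis using assms by (simp add: sum_mono_mult)
qed

section \<open>Linearity and expansion in monomials\<close>

lemma dpart_add: "dpart p r n t i (\<lambda>c. f c + g c) c = dpart p r n t i f c + dpart p r n t i g c"
  by (simp add: dpart_def algebra_simps sum.distrib)

lemma dpart_scale: "dpart p r n t i (\<lambda>c. s * f c) c = s * dpart p r n t i f c"
  by (simp add: dpart_def sum_distrib_left mult.assoc)

lemma dpart_zero [simp]: "dpart p r n t i (\<lambda>c. 0) = (\<lambda>c. 0)"
  by (rule ext) (simp add: dpart_def)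

lemma dpart_sum: "dpart p r n t i (\<lambda>c. \<Sum>x\<in>S. f x c) c = (\<Sum>x\<in>S. dpart p r n t i (f x) c)"
  unfolding dpart_def sum_distrib_right by (rule sum.swap)

lemma Omult_scale_left: "Omult p r n t (\<lambda>c. s * f c) g c = s * Omult p r n t f g c"
  by (simp add: Omult_expand sum_distrib_left mult.assoc)

lemma Omult_scale_right: "Omult p r n t f (\<lambda>c. s * g c) c = s * Omult p r n t f g c"
  by (simp add: Omult_expand sum_distrib_left mult_ac)

lemma Omult_zero [simp]: "Omult p r n t (\<lambda>c. 0) g c = 0" "Omult p r n t f (\<lambda>c. 0) c = 0"
  by (simp_all add: Omult_expand)

lemma Omult_sum_right:
  "Omult p r n t f (\<lambda>c. \<Sum>x\<in>S. g x c) c = (\<Sum>x\<in>S. Omult p r n t f (g x) c)"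
proof -
  have "Omult p r n t f (\<lambda>c. \<Sum>x\<in>S. g x c) c =
     (\<Sum>a\<in>Basis p r n t. \<Sum>x\<in>S. \<Sum>b\<in>Basis p r n t. f a * g x b * mult_basis p r t a b c)"
    unfolding Omult_expand sum_distrib_left sum_distrib_right by (intro sum.cong refl sum.swap)
  also have "\<dots> = (\<Sum>x\<in>S. Omult p r n t f (g x) c)"
    unfolding Omult_expand by (rule sum.swap)
  finally show ?thesis .
qed

lemma Omult_sum_left:
  "Omult p r n t (\<lambda>c. \<Sum>x\<in>S. f x c) g c = (\<Sum>x\<in>S. Omult p r n t (f x) g c)"
proof -
  have "Omult p r n t (\<lambda>c. \<Sum>x\<in>S. f x c) g c =
     (\<Sum>a\<in>Basis p r n t. \<Sum>x\<in>S. \<Sum>b\<in>Basis p r n t. f x a * g b * mult_basis p r t a b c)"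
    unfolding Omult_expand sum_distrib_left sum_distrib_right by (intro sum.cong refl sum.swap)
  also have "\<dots> = (\<Sum>x\<in>S. Omult p r n t (f x) g c)"
    unfolding Omult_expand by (rule sum.swap)
  finally show ?thesis .
qed

lemma dpart_mono:
  "a \<in> Basis p r n t \<Longrightarrow> dpart p r n t i (mono a) c = dpart_basis r n i a c"
  by (simp add: dpart_def sum_mono_mult)

lemma dpart_expand:
  "dpart p r n t i f c = (\<Sum>a\<in>Basis p r n t. f a * dpart p r n t i (mono a) c)"
  unfolding dpart_def [of _ _ _ _ _ f] by (rule sum.cong) (simp_all add: dpart_mono)

section \<open>Parity and the Leibniz rule\<close>

lemma Omult_expand_left:
  "Omult p r n t f g c = (\<Sum>a\<in>Basis p r n t. f a * Omult p r n t (mono a) g c)"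
proof -
  have "Omult p r n t (mono a) g c = (\<Sum>b\<in>Basis p r n t. g b * mult_basis p r t a b c)"
    if "a \<in> Basis p r n t" for a
  proof -
    have "Omult p r n t (mono a) g c =
        (\<Sum>a'\<in>Basis p r n t. mono a a' * (\<Sum>b\<in>Basis p r n t. g b * mult_basis p r t a' b c))"
      by (simp add: Omult_expand sum_distrib_left mult.assoc)
    then show ?thesis using that by (simp add: sum_mono_mult)
  qed
  then show ?thesis by (simp add: Omult_expand sum_distrib_left mult.assoc)
qed

lemma Omult_expand_right:
  "Omult p r n t f g c = (\<Sum>b\<in>Basis p r n t. g b * Omult p r n t f (mono b) c)"
proof -
  have "Omult p r n t f g c = (\<Sum>b\<in>Basis p r n t. \<Sum>a\<in>Basis p r n t. g b * (f a * mult_basis p r t a b c))"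
    unfolding Omult_expand by (subst sum.swap) (simp add: mult_ac)
  also have "\<dots> = (\<Sum>b\<in>Basis p r n t. g b * Omult p r n t f (mono b) c)"
    by (subst Omult_expand_left) (simp add: Omult_mono sum_distrib_left cong: sum.cong)
  finally show ?thesis .
qed

text \<open>Only the parity of q matters. Allowing any natural number lets parities be added without
  reduction, and 0 is homogeneous of every parity.\<close>

definition homog :: "nat \<Rightarrow> 'a::field Oel \<Rightarrow> bool" where
  "homog q f \<longleftrightarrow> (\<forall>c. f c \<noteq> 0 \<longrightarrow> even (card (snd c) + q))"

lemma homog_mono: "homog (card (snd a)) (mono a)"
  by (auto simp: homog_def mono_def)

lemma homog_parity: "homog q f \<Longrightarrow> f c \<noteq> 0 \<Longrightarrow> even (card (snd c)) = even q"
  by (cases c) (simp add: homog_def)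

lemma dpart_basis_I1:
  assumes "i \<in> I1 r n" "finite u"
  shows "dpart_basis r n i (\<alpha>, u) = (if i \<in> u then \<lambda>c. ins_sgn i u * mono (\<alpha>, u - {i}) c else (\<lambda>c. 0))"
  using assms I0_I1_disjoint(2) [OF assms(1)] by (auto simp: dpart_basis_def ins_sgn_card)

lemma dpart_basis_I0:
  assumes "i \<in> I0 r"
  shows "dpart_basis r n i (\<alpha>, u) = (if 1 \<le> \<alpha> i then mono (\<alpha>(i := \<alpha> i - 1), u) else (\<lambda>c. 0))"
  using assms by (simp add: dpart_basis_def)

lemma homog_dpart:
  assumes "homog q f" shows "homog (muI r n i + q) (dpart p r n t i f)"
  unfolding homog_def
proof (intro allI impI)
  fix c assume nz: "dpart p r n t i f c \<noteq> 0"
  obtain \<gamma> v where c: "c = (\<gamma>, v)" by (cases c)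
  consider "i \<in> I0 r" | "i \<in> I1 r n" | "i \<notin> Iall r n" by (auto simp: Iall_def)
  then show "even (card (snd c) + (muI r n i + q))"
  proof cases
    case 1
    then show ?thesis using nz assms
      by (auto simp: c dpart_I0 muI_def I0_I1_disjoint homog_def split: if_splits)
  next
    case 2
    then have "i \<notin> v" "(\<gamma>, insert i v) \<in> Basis p r n t" "f (\<gamma>, insert i v) \<noteq> 0"
      using nz by (auto simp: c dpart_I1 split: if_splits)
    moreover from this(2) have "finite v" using finite_Basis_snd by force
    ultimately show ?thesis using 2 assms by (force simp: c muI_def homog_def)
  next
    case 3
    then show ?thesis using nz by (simp add: dpart_outside_index)
  qed
qed

lemma mult_basis_nonzeroD:
  assumes "mult_basis p r t (\<alpha>, u) (\<beta>, v) (\<gamma>, w) \<noteq> 0"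
  shows "u \<inter> v = {}" "w = u \<union> v" "(\<lambda>i. \<alpha> i + \<beta> i) = \<gamma>" "\<gamma> \<in> Aset p r t"
  using assms by (simp_all add: mult_basis_eq split: if_splits)

text \<open>Supercommutativity is checked on pairs of monomials: the binomials are symmetric, and
  reordering the odd factors gives the sign of \<open>sgn_uv_commute\<close>.\<close>

lemma Omult_commute:
  assumes "homog q f" "homog q' g"
  shows "Omult p r n t f g c = (-1) ^ (q * q') * Omult p r n t g f c"
proof -
  have "f a * g b * mult_basis p r t a b c = (-1) ^ (q * q') * (g b * f a * mult_basis p r t b a c)"
    if ab: "a \<in> Basis p r n t" "b \<in> Basis p r n t" for a b
  proof (cases "f a = 0 \<or> g b = 0")
    case False
    obtain \<alpha> u \<beta> v where [simp]: "a = (\<alpha>, u)" "b = (\<beta>, v)" by (cases a; cases b)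
    have fin: "finite u" "finite v" using ab finite_Basis_snd by auto
    have "even (card u) = even q" "even (card v) = even q'"
      using False assms homog_parity by force+
    then have "(-1) ^ (card u * card v) = ((-1) ^ (q * q') :: 'a)"
      by (simp add: minus_one_power_iff)
    then have "sgn_uv u v = (-1) ^ (q * q') * (sgn_uv v u :: 'a)" if "u \<inter> v = {}"
      using sgn_uv_commute [OF fin that] by metis
    then have "mult_basis p r t a b c = (-1) ^ (q * q') * (mult_basis p r t b a c :: 'a)"
      using
      binomial_symmetric [of "\<alpha> i" "\<alpha> i + \<beta> i" for i]
      by (simp add: mult_basis_eq add.commute [of "\<beta> _"] Un_commute [of v] Int_commute [of v])
    then show ?thesis by simp
  qed auto
  then have "Omult p r n t f g c = (-1) ^ (q * q') *
      (\<Sum>a\<in>Basis p r n t. \<Sum>b\<in>Basis p r n t. g b * f a * mult_basis p r t b a c)"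
    unfolding Omult_expand sum_distrib_left by (intro sum.cong refl)
  also have "(\<Sum>a\<in>Basis p r n t. \<Sum>b\<in>Basis p r n t. g b * f a * mult_basis p r t b a c) = Omult p r n t g f c"
    unfolding Omult_expand by (rule sum.swap)
  finally show ?thesis .
qed

lemma dpart_commute:
  "dpart p r n t i (dpart p r n t j f) c =
    (-1) ^ (muI r n i * muI r n j) * dpart p r n t j (dpart p r n t i f) c"
proof -
  obtain \<gamma> v where c: "c = (\<gamma>, v)" by (cases c)
  have [simp]: "finite v" if "v \<subseteq> I1 r n" using finite_subset [OF that] by simp
  consider "i \<notin> Iall r n \<or> j \<notin> Iall r n" | "i = j" | "i \<in> I0 r" "j \<in> I0 r" "i \<noteq> j" | "i \<in> I0 r" "j \<in> I1 r n" | "i \<in> I1 r n" "j \<in> I0 r"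
    | "i \<in> I1 r n" "j \<in> I1 r n" "i \<noteq> j" by (auto simp: Iall_def)
  then show ?thesis
  proof cases
    case 1
    then show ?thesis by (auto simp: dpart_outside_index)
  next
    \<comment> \<open>For odd i both sides vanish, because d_i d_i = 0; otherwise the sign is
      1.\<close>
    case 2
    then show ?thesis by (cases "i \<in> I1 r n") (simp_all add: c dpart_I1 muI_def)
  next
    case 3
    have "\<gamma>(i := Suc (\<gamma> i)) \<in> Aset p r t \<and> \<gamma>(j := Suc (\<gamma> j)) \<in> Aset p r t"
      if "\<gamma>(i := Suc (\<gamma> i), j := Suc (\<gamma> j)) \<in> Aset p r t"
      using that by (auto elim!: Aset_downward)
    then show ?thesis using 3
      by (auto simp: c dpart_I0 muI_def I0_I1_disjoint Basis_iff fun_upd_twist dest: Aset_upd_Suc)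
  next
    case 4
    then show ?thesis
      by (auto simp: c dpart_I0 dpart_I1 muI_def I0_I1_disjoint Basis_iff dest: Aset_upd_Suc)
  next
    case 5
    then show ?thesis
      by (auto simp: c dpart_I0 dpart_I1 muI_def I0_I1_disjoint Basis_iff dest: Aset_upd_Suc)
  next
    case 6
    then show ?thesis
      by (auto simp: c dpart_I1 muI_def Basis_iff insert_commute ins_sgn_insert)
  qed
qed

section \<open>The Leibniz rule in characteristic p\<close>

locale ham =
  fixes p r n :: nat and t :: "nat \<Rightarrow> nat" and ty :: "'a::field itself"
  assumes prime_p: "prime p" and p_gt: "p > 3" and char_p: "CHAR('a) = p"
    and r_pos: "r > 0" and n_pos: "n > 0" and t_pos: "\<And>i. i \<in> I0 r \<Longrightarrow> t i > 0"
begin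

abbreviation dd :: "nat \<Rightarrow> 'a Oel \<Rightarrow> 'a Oel" where "dd \<equiv> dpart p r n t"
abbreviation mul :: "'a Oel \<Rightarrow> 'a Oel \<Rightarrow> 'a Oel"  (infixl "\<star>" 70) where "f \<star> g \<equiv> Omult p r n t f g"
abbreviation BB where "BB \<equiv> Basis p r n t"
abbreviation M :: "bidx \<Rightarrow> bidx \<Rightarrow> 'a Oel" where "M \<equiv> mult_basis p r t"
abbreviation pie where "pie \<equiv> piv p r t"

text \<open>Pascal's rule survives the truncation x^(gamma) = 0 beyond the bound: the first excluded
  exponent is p^t, and the binomials in question vanish modulo p.\<close>

lemma truncated_Pascal:
  assumes "i \<in> I0 r" "a \<le> pie i" "b \<le> pie i" "a + b = Suc d" "d \<le> pie i"
  shows "(if Suc d \<le> pie i then of_nat (Suc d choose a) else 0 :: 'a) =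
    (if 1 \<le> a then of_nat (d choose (a - 1)) else 0) + (if 1 \<le> b then of_nat (d choose a) else 0)"
proof -
  have pie: "Suc (pie i) = p ^ t i" using assms(1) prime_p prime_gt_0_nat by (simp add: piv_def)
  have "(of_nat (Suc d choose a) :: 'a) = 0" if "\<not> Suc d \<le> pie i"
  proof -
    \<comment> \<open>Here a > 0, since otherwise b = p^t would exceed its bound; the bound on a
      gives a < p^t.\<close>
    have "Suc d = p ^ t i" "0 < a" "a < p ^ t i" using that assms pie by auto
    then have "p dvd (Suc d choose a)" using prime_dvd_choose_prime_power prime_p by metis
    then show ?thesis using char_p by (simp add: of_nat_eq_0_iff_char_dvd)
  qed
  moreover have "(of_nat (Suc d choose a) :: 'a) =
    (if 1 \<le> a then of_nat (d choose (a - 1)) else 0) + (if 1 \<le> b then of_nat (d choose a) else 0)"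
    using assms(4) by (cases a) (auto simp: not_less_eq_eq binomial_eq_0)
  ultimately show ?thesis by simp
qed

text \<open>Only the coordinate i changes: both sides are the truncated Pascal rule there, times a
  common factor from the other coordinates. If the exponents or odd parts do not match, all terms
  vanish.\<close>

lemma dpart_mult_basis_I0:
  assumes i: "i \<in> I0 r" and ab: "(\<alpha>, u) \<in> BB" "(\<beta>, v) \<in> BB"
  shows "dd i (M (\<alpha>, u) (\<beta>, v)) (\<delta>, w) =
    (if 1 \<le> \<alpha> i then M (\<alpha>(i := \<alpha> i - 1), u) (\<beta>, v) (\<delta>, w) else 0) +
    (if 1 \<le> \<beta> i then M (\<alpha>, u) (\<beta>(i := \<beta> i - 1), v) (\<delta>, w) else 0)"
proof (cases "u \<inter> v = {} \<and> w = u \<union> v \<and> (\<lambda>j. \<alpha> j + \<beta> j) = \<delta>(i := Suc (\<delta> i)) \<and> \<delta> \<in> Aset p r t")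
  case False
  have "\<alpha> i \<ge> 1 \<Longrightarrow> \<delta> = (\<lambda>j. (\<alpha>(i := \<alpha> i - 1)) j + \<beta> j) \<Longrightarrow> (\<lambda>j. \<alpha> j + \<beta> j) = \<delta>(i := Suc (\<delta> i))"
    "\<beta> i \<ge> 1 \<Longrightarrow> \<delta> = (\<lambda>j. \<alpha> j + (\<beta>(i := \<beta> i - 1)) j) \<Longrightarrow> (\<lambda>j. \<alpha> j + \<beta> j) = \<delta>(i := Suc (\<delta> i))"
    by (auto simp: fun_eq_iff)
  then have "1 \<le> \<alpha> i \<Longrightarrow> M (\<alpha>(i := \<alpha> i - 1), u) (\<beta>, v) (\<delta>, w) = 0"
    "1 \<le> \<beta> i \<Longrightarrow> M (\<alpha>, u) (\<beta>(i := \<beta> i - 1), v) (\<delta>, w) = 0"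
    using False mult_basis_nonzeroD by (metis (no_types, lifting))+
  moreover have "dd i (M (\<alpha>, u) (\<beta>, v)) (\<delta>, w) = 0"
  proof (rule ccontr)
    assume "dd i (M (\<alpha>, u) (\<beta>, v)) (\<delta>, w) \<noteq> 0"
    then have "M (\<alpha>, u) (\<beta>, v) (\<delta>(i := Suc (\<delta> i)), w) \<noteq> 0"
      by (simp add: dpart_I0 [OF i] split: if_splits)
    from mult_basis_nonzeroD [OF this] Aset_upd_Suc False show False by metis
  qed
  ultimately show ?thesis by simp
next
  case True
  then have \<delta>: "\<delta> \<in> Aset p r t" and eq: "\<alpha> i + \<beta> i = Suc (\<delta> i)"
    and eqs: "\<And>j. j \<noteq> i \<Longrightarrow> \<alpha> j + \<beta> j = \<delta> j" and uv: "u \<inter> v = {}" "w = u \<union> v" "w \<subseteq> I1 r n"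
    and sum: "(\<lambda>j. \<alpha> j + \<beta> j) = \<delta>(i := Suc (\<delta> i))"
    using ab by (auto simp: Basis_iff fun_eq_iff)
  have le: "\<alpha> i \<le> pie i" "\<beta> i \<le> pie i" "\<delta> i \<le> pie i" using \<delta> ab by (auto simp: Basis_iff Aset_def)
  have mem: "\<delta>(i := Suc (\<delta> i)) \<in> Aset p r t \<longleftrightarrow> Suc (\<delta> i) \<le> pie i"
    using \<delta> by (auto simp: Aset_def)
  have s1: "(\<lambda>j. (\<alpha>(i := \<alpha> i - 1)) j + \<beta> j) = \<delta>" if "1 \<le> \<alpha> i" using that eq eqs by (auto simp: fun_eq_iff)
  have s2: "(\<lambda>j. \<alpha> j + (\<beta>(i := \<beta> i - 1)) j) = \<delta>" if "1 \<le> \<beta> i" using that eq eqs by (auto simp: fun_eq_iff)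
  \<comment> \<open>The binomials at the coordinates other than i, shared by all three
    products.\<close>
  define R where "R = (\<Prod>j\<in>I0 r - {i}. \<delta> j choose \<alpha> j)"
  have pr: "(\<Prod>j\<in>I0 r. (\<delta>(i := d)) j choose (\<alpha>(i := a)) j) = (d choose a) * R" for d a
    unfolding R_def using i by (subst prod.remove [of _ i]) auto
  have p0: "(\<Prod>j\<in>I0 r. \<alpha> j + \<beta> j choose \<alpha> j) = (Suc (\<delta> i) choose \<alpha> i) * R"
    using pr [of "Suc (\<delta> i)" "\<alpha> i"] by (simp add: fun_cong [OF sum])
  have p1: "(\<Prod>j\<in>I0 r. (\<alpha>(i := \<alpha> i - 1)) j + \<beta> j choose (\<alpha>(i := \<alpha> i - 1)) j) = (\<delta> i choose (\<alpha> i - 1)) * R"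
    if "1 \<le> \<alpha> i"
    using pr [of "\<delta> i" "\<alpha> i - 1"] fun_cong [OF s1 [OF that]] by simp
  have p2: "(\<Prod>j\<in>I0 r. \<alpha> j + (\<beta>(i := \<beta> i - 1)) j choose \<alpha> j) = (\<delta> i choose \<alpha> i) * R"
    if "1 \<le> \<beta> i"
    using pr [of "\<delta> i" "\<alpha> i"] fun_cong [OF s2 [OF that]] by simp
  have "dd i (M (\<alpha>, u) (\<beta>, v)) (\<delta>, w) =
      (if Suc (\<delta> i) \<le> pie i then of_nat (Suc (\<delta> i) choose \<alpha> i) else 0) * (of_nat R * sgn_uv u v)"
    using uv by (simp add: dpart_I0 [OF i] mult_basis_eq Basis_iff sum mem p0 del: binomial_Suc_Suc)
  also have "\<dots> = (if 1 \<le> \<alpha> i then of_nat (\<delta> i choose (\<alpha> i - 1)) * (of_nat R * sgn_uv u v) else 0) +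
      (if 1 \<le> \<beta> i then of_nat (\<delta> i choose \<alpha> i) * (of_nat R * sgn_uv u v) else 0)"
    unfolding truncated_Pascal [OF i le(1,2) eq le(3)] by (simp add: distrib_right)
  also have "\<dots> = (if 1 \<le> \<alpha> i then M (\<alpha>(i := \<alpha> i - 1), u) (\<beta>, v) (\<delta>, w) else 0) +
    (if 1 \<le> \<beta> i then M (\<alpha>, u) (\<beta>(i := \<beta> i - 1), v) (\<delta>, w) else 0)"
    unfolding mult_basis_eq using uv \<delta> s1 s2 p1 p2 by (intro arg_cong2 [where f = "(+)"]) auto
  finally show ?thesis .
qed

lemma dpart_mult_basis_I1:
  assumes i: "i \<in> I1 r n" and ab: "(\<alpha>, u) \<in> BB" "(\<beta>, v) \<in> BB"
  shows "dd i (M (\<alpha>, u) (\<beta>, v)) (\<delta>, w) =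
    (if i \<in> u then ins_sgn i u * M (\<alpha>, u - {i}) (\<beta>, v) (\<delta>, w) else 0) +
    (-1) ^ card u * (if i \<in> v then ins_sgn i v * M (\<alpha>, u) (\<beta>, v - {i}) (\<delta>, w) else 0)"
proof (cases "(\<lambda>j. \<alpha> j + \<beta> j) = \<delta> \<and> \<delta> \<in> Aset p r t")
  case False
  then have "M (\<alpha>, x) (\<beta>, y) (\<delta>, z) = 0" for x y z
    using mult_basis_nonzeroD(3,4) by (metis (no_types, lifting))
  then show ?thesis by (simp add: dpart_I1 [OF i])
next
  case True
  then have sum: "(\<lambda>j. \<alpha> j + \<beta> j) = \<delta>" and \<delta>: "\<delta> \<in> Aset p r t" by auto
  have sub: "u \<subseteq> I1 r n" "v \<subseteq> I1 r n" using ab by (auto simp: Basis_iff)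
  have fin: "finite u" "finite v" using ab finite_Basis_snd by auto
  define R where "R = (of_nat (\<Prod>i\<in>I0 r. \<alpha> i + \<beta> i choose \<alpha> i) :: 'a)"
  have Meq: "M (\<alpha>, x) (\<beta>, y) (\<delta>, z) = (if x \<inter> y = {} \<and> z = x \<union> y then R * sgn_uv x y else 0)" for x y z
    using \<delta> by (auto simp: mult_basis_eq sum R_def)
  consider "i \<notin> u" "i \<notin> v" | u0 where "i \<notin> u0" "u = insert i u0" "i \<notin> v" | v0 where "i \<notin> v0" "v = insert i v0" "i \<notin> u"
    | u0 v0 where "i \<notin> u0" "u = insert i u0" "i \<notin> v0" "v = insert i v0"
    by (metis mk_disjoint_insert)
  then show ?thesis
  proof cases
    case 1
    then show ?thesis by (auto simp: dpart_I1 [OF i] Meq)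
  next
    case 2
    then have w: "i \<notin> w \<and> insert i w = insert i u0 \<union> v \<longleftrightarrow> w = u0 \<union> v" by auto
    show ?thesis using 2 w fin sub \<delta>
      by (auto simp: dpart_I1 [OF i] Meq Basis_iff sgn_uv_insert_left ins_sgn_insert_self ins_sgn_union)
  next
    case 3
    then have w: "i \<notin> w \<and> insert i w = u \<union> insert i v0 \<longleftrightarrow> w = u \<union> v0" by auto
    show ?thesis using 3 w fin sub \<delta>
      by (auto simp: dpart_I1 [OF i] Meq Basis_iff sgn_uv_insert_right ins_sgn_insert_self ins_sgn_union)
  next
    \<comment> \<open>The product contains x_i twice and is 0; on the right the two terms
      cancel.\<close>
    case 4
    then show ?thesis using fin
      by (auto simp: dpart_I1 [OF i] Meq sgn_uv_insert_right sgn_uv_insert_left ins_sgn_insert_self)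
  qed
qed

lemma Leibniz_mono:
  assumes "i \<in> Iall r n" "a \<in> BB" "b \<in> BB"
  shows "dd i (M a b) c = (dd i (mono a) \<star> mono b) c + (-1) ^ (muI r n i * card (snd a)) * (mono a \<star> dd i (mono b)) c"
proof -
  obtain \<alpha> u \<beta> v \<delta> w where e: "a = (\<alpha>, u)" "b = (\<beta>, v)" "c = (\<delta>, w)" by (cases a; cases b; cases c)
  have dm: "dd i (mono (\<alpha>, u)) = dpart_basis r n i (\<alpha>, u)" "dd i (mono (\<beta>, v)) = dpart_basis r n i (\<beta>, v)"
    using assms by (auto simp: e dpart_mono)
  have fin: "finite u" "finite v" using assms e finite_Basis_snd by auto
  have mem: "(\<alpha>(i := \<alpha> i - 1), u) \<in> BB" "(\<beta>(i := \<beta> i - 1), v) \<in> BB" "(\<alpha>, u - {i}) \<in> BB" "(\<beta>, v - {i}) \<in> BB"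
    using assms by (auto simp: e Basis_iff Aset_def intro: le_trans [OF diff_le_self])
  show ?thesis
  proof (cases "i \<in> I0 r")
    case True
    then show ?thesis using assms mem
      by (simp add: dm e dpart_mult_basis_I0 dpart_basis_I0 Omult_mono muI_def I0_I1_disjoint)
  next
    case False
    then have "i \<in> I1 r n" using assms by (simp add: Iall_def)
    then show ?thesis using assms mem
      by (simp add: dm e dpart_mult_basis_I1 dpart_basis_I1 fin Omult_mono muI_def Omult_scale_left Omult_scale_right)
  qed
qed

lemma Leibniz:
  assumes "i \<in> Iall r n" "homog q f"
  shows "dd i (f \<star> g) c = (dd i f \<star> g) c + (-1) ^ (muI r n i * q) * (f \<star> dd i g) c"
proof -
  have "dd i (f \<star> g) c = (\<Sum>a\<in>BB. \<Sum>b\<in>BB. f a * g b * dd i (M a b) c)"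
    unfolding Omult_expand [abs_def] by (simp add: dpart_sum dpart_scale)
  also have "\<dots> = (\<Sum>a\<in>BB. \<Sum>b\<in>BB. f a * g b * (dd i (mono a) \<star> mono b) c +
      (-1) ^ (muI r n i * q) * (f a * g b * (mono a \<star> dd i (mono b)) c))"
  proof (intro sum.cong refl)
    fix a b assume ab: "a \<in> BB" "b \<in> BB"
    \<comment> \<open>Each monomial that occurs in f has the parity q of f, so one sign serves the
      whole sum.\<close>
    have "f a = 0 \<or> (-1 :: 'a) ^ (muI r n i * card (snd a)) = (-1) ^ (muI r n i * q)"
      using homog_parity [OF assms(2), of a] by (auto simp: minus_one_power_iff)
    then show "f a * g b * dd i (M a b) c = f a * g b * (dd i (mono a) \<star> mono b) c +
      (-1) ^ (muI r n i * q) * (f a * g b * (mono a \<star> dd i (mono b)) c)"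
      unfolding Leibniz_mono [OF assms(1) ab] by (auto simp: algebra_simps)
  qed
  also have "\<dots> = (\<Sum>a\<in>BB. \<Sum>b\<in>BB. f a * g b * (dd i (mono a) \<star> mono b) c) +
      (-1) ^ (muI r n i * q) * (\<Sum>a\<in>BB. \<Sum>b\<in>BB. f a * g b * (mono a \<star> dd i (mono b)) c)"
    by (simp add: sum.distrib sum_distrib_left)
  also have "(\<Sum>a\<in>BB. \<Sum>b\<in>BB. f a * g b * (dd i (mono a) \<star> mono b) c) = (dd i f \<star> g) c"
    unfolding dpart_expand [of p r n t i f, abs_def] Omult_sum_left Omult_scale_left
    by (simp add: Omult_expand_right [of p r n t _ g] sum_distrib_left mult.assoc)
  also have "(\<Sum>a\<in>BB. \<Sum>b\<in>BB. f a * g b * (mono a \<star> dd i (mono b)) c) = (f \<star> dd i g) c"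
    unfolding dpart_expand [of p r n t i g, abs_def] Omult_sum_right Omult_scale_right
    by (subst sum.swap) (simp add: Omult_expand_left [of p r n t f] sum_distrib_left mult_ac)
  finally show ?thesis .
qed

end

section \<open>The Poisson bracket\<close>

lemma homog_Omult:
  fixes f g :: "'a::field Oel"
  assumes "homog q f" "homog q' g" shows "homog (q + q') (Omult p r n t f g)"
  unfolding homog_def
proof (intro allI impI)
  fix c assume "Omult p r n t f g c \<noteq> 0"
  then obtain a where a: "a \<in> Basis p r n t"
    and "(\<Sum>b\<in>Basis p r n t. f a * g b * mult_basis p r t a b c) \<noteq> 0"
    unfolding Omult_expand by (rule sum.not_neutral_contains_not_neutral)
  from this(2) obtain b where b: "b \<in> Basis p r n t"
    and "f a * g b * mult_basis p r t a b c \<noteq> 0"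
    by (rule sum.not_neutral_contains_not_neutral)
  then have ab: "a \<in> Basis p r n t" "b \<in> Basis p r n t"
    and nz: "f a \<noteq> 0" "g b \<noteq> 0" "mult_basis p r t a b c \<noteq> (0 :: 'a)" using a by auto
  obtain \<alpha> u \<beta> v \<gamma> w where e: "a = (\<alpha>, u)" "b = (\<beta>, v)" "c = (\<gamma>, w)" by (cases a; cases b; cases c)
  have "card w = card u + card v"
    using mult_basis_nonzeroD(1,2) [OF nz(3) [unfolded e]] ab finite_Basis_snd
    by (auto simp: e card_Un_disjoint)
  then show "even (card (snd c) + (q + q'))"
    using homog_parity [OF assms(1) nz(1)] homog_parity [OF assms(2) nz(2)] by (simp add: e)
qed

lemma homog_scale: "homog q f \<Longrightarrow> homog q (\<lambda>c. s * f c)"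
  by (auto simp: homog_def)

lemma homog_sum: "(\<And>x. x \<in> S \<Longrightarrow> homog q (f x)) \<Longrightarrow> homog q (\<lambda>c. \<Sum>x\<in>S. f x c)"
  unfolding homog_def by (metis (no_types, lifting) sum.neutral)

lemma homog_cong_parity: "homog q f \<Longrightarrow> even q = even q' \<Longrightarrow> homog q' f"
  by (simp add: homog_def)

section \<open>The pairing of indices and its signs\<close>

lemma primeI_I0: "i \<in> I0 r \<Longrightarrow> primeI r n i \<in> I0 r"
  by (auto simp: I0_def primeI_def Let_def)

lemma primeI_I1: "i \<in> I1 r n \<Longrightarrow> primeI r n i \<in> I1 r n"
  using div_times_less_eq_dividend [of n 2] by (auto simp: I1_def primeI_def Let_def)

lemma primeI_Iall: "i \<in> Iall r n \<Longrightarrow> primeI r n i \<in> Iall r n"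
  by (auto simp: Iall_def primeI_I0 primeI_I1)

text \<open>The pairing swaps the halves of I_0 and of the paired part of I_1 and fixes every other
  number, also outside I, so no range condition is attached.\<close>

lemma primeI_primeI [simp]: "primeI r n (primeI r n i) = i"
proof -
  define s where "s = n div 2"
  have pr: "primeI r n i = (if 1 \<le> i \<and> i \<le> r then i + r else if r < i \<and> i \<le> 2*r then i - r
      else if 2*r < i \<and> i \<le> 2*r + s then i + s else if 2*r + s < i \<and> i \<le> 2*r + 2*s then i - s else i)" for i
    by (simp only: primeI_def Let_def s_def)
  consider "1 \<le> i" "i \<le> r" | "r < i" "i \<le> 2*r" | "2*r < i" "i \<le> 2*r + s"
    | "2*r + s < i" "i \<le> 2*r + 2 * s" | "i = 0 \<or> i > 2*r + 2 * s"
    by linarith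
  then show ?thesis
  proof cases
    case 2
    then have "1 \<le> i - r" "i - r \<le> r" by linarith+
    with 2 show ?thesis by (simp add: pr [of i] pr [of "i - r"])
  next
    case 4
    then have "\<not> i \<le> r" "\<not> i \<le> 2*r" "2*r < i - s" "\<not> i - s \<le> r" "i - s \<le> 2*r + s" by linarith+
    with 4 show ?thesis by (simp add: pr [of i] pr [of "i - s"])
  next
    case 5
    then have "primeI r n i = i" by (auto simp: pr [of i])
    then show ?thesis by simp
  qed (simp_all add: pr)
qed

lemma bij_betw_primeI:
  assumes "S = I0 r \<or> S = I1 r n \<or> S = Iall r n"
  shows "bij_betw (primeI r n) S S"
  by (rule bij_betw_byWitness [where f' = "primeI r n"])
    (use assms primeI_I0 primeI_I1 primeI_Iall in auto)

lemma sum_primeI: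
  assumes "S = I0 r \<or> S = I1 r n \<or> S = Iall r n"
  shows "(\<Sum>j\<in>S. h (primeI r n j)) = (\<Sum>j\<in>S. h j)"
  by (rule sum.reindex_bij_betw [OF bij_betw_primeI [OF assms]])

lemma muI_primeI [simp]: "muI r n (primeI r n i) = muI r n i"
  by (metis muI_def primeI_I1 primeI_primeI)

lemma primeI_I1_iff [simp]: "primeI r n i \<in> I1 r n \<longleftrightarrow> i \<in> I1 r n"
  by (metis primeI_I1 primeI_primeI)

text \<open>The underlying form is skew on even indices and symmetric on odd ones.\<close>

lemma tauI_primeI: "i \<in> Iall r n \<Longrightarrow> tauI r (primeI r n i) = - ((-1) ^ muI r n i) * tauI r i"
  by (auto simp: tauI_def primeI_def Let_def Iall_def I0_def I1_def muI_def)

lemma tauI_nonzero [simp]: "tauI r i \<noteq> 0"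
  by (simp add: tauI_def)

lemma tauI_I1: "i \<in> I1 r n \<Longrightarrow> tauI r i = 1"
  by (simp add: tauI_def I1_def)

text \<open>Priming is an involution, so the sum has the single term i = k'.\<close>

lemma DH_eq:
  "DH p r n t q f k c = (if k \<in> Iall r n
     then tauI r (primeI r n k) * (-1) ^ (muI r n k * q) * dpart p r n t (primeI r n k) f c else 0)"
proof -
  have iff: "primeI r n i = k \<longleftrightarrow> i = primeI r n k" for i by auto
  have "primeI r n k \<in> Iall r n \<longleftrightarrow> k \<in> Iall r n" using primeI_Iall primeI_primeI by metis
  then show ?thesis unfolding DH_def iff by simp
qed

context ham
begin

section \<open>Hamiltonian fields and their brackets\<close>

definition act :: "'a Wel \<Rightarrow> 'a Oel \<Rightarrow> 'a Oel" where
  "act D g = (\<lambda>c. \<Sum>j\<in>Iall r n. (D j \<star> dd j g) c)"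

text \<open>The Poisson bracket as D_H(f) applied to g, for even f: the signs (-1)^(mu(j) p(f)) of
  D_H are then 1.\<close>

definition pb :: "'a Oel \<Rightarrow> 'a Oel \<Rightarrow> 'a Oel" where
  "pb f g = (\<lambda>c. \<Sum>j\<in>Iall r n. tauI r j * (dd j f \<star> dd (primeI r n j) g) c)"

definition even_field :: "'a Wel \<Rightarrow> bool" where
  "even_field D \<longleftrightarrow> (\<forall>k\<in>Iall r n. homog (muI r n k) (D k))"

lemma two_nonzero: "(2 :: 'a) \<noteq> 0"
proof
  assume "(2 :: 'a) = 0"
  then have "of_nat 2 = (0 :: 'a)" by simp
  then have "p dvd 2" unfolding of_nat_eq_0_iff_char_dvd char_p .
  then have "p \<le> 2" by (rule dvd_imp_le) simp
  then show False using p_gt by simp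
qed

lemma eq_minus_self_zero: "x = - x \<Longrightarrow> x = (0 :: 'a)"
  using two_nonzero by (metis add.right_inverse mult_2 mult_eq_0_iff)

lemma Omult_dpart_expand:
  "(f \<star> dd i g) c = (\<Sum>a\<in>BB. \<Sum>b\<in>BB. f a * g b * (mono a \<star> dd i (mono b)) c)"
  unfolding dpart_expand [of p r n t i g, abs_def] Omult_sum_right Omult_scale_right
  by (subst sum.swap) (simp add: Omult_expand_left [of p r n t f] sum_distrib_left mult_ac)

lemma Omult_dpart_expand_swap:
  "(\<Sum>a\<in>BB. \<Sum>b\<in>BB. g a * f b * (mono b \<star> dd i (mono a)) c) = (f \<star> dd i g) c"
  by (subst Omult_dpart_expand, subst sum.swap) (simp add: mult.commute)

lemma brW_outside: "k \<notin> Iall r n \<Longrightarrow> brW p r n t D E k c = 0"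
  unfolding brW_def bracket_basis_def by (intro sum.neutral ballI) auto

text \<open>If one field is even, the exponent in the sign of the bracket is even for every pair of
  terms, and the bracket is the ordinary commutator of derivations, component by component.\<close>

lemma brW_even_field:
  assumes "even_field D \<or> even_field E" and k: "k \<in> Iall r n"
  shows "brW p r n t D E k c = act D (E k) c - act E (D k) c"
proof -
  have sgn: "D i a * E j b * ((-1) ^ (parW r n a i * parW r n b j) * y) = D i a * E j b * y"
    if "i \<in> Iall r n" "j \<in> Iall r n" for i j a b y
  proof (cases "D i a = 0 \<or> E j b = 0")
    case False
    then have "even (parW r n a i) \<or> even (parW r n b j)"
      using assms(1) that unfolding even_field_def homog_def parW_def by blast
    then show ?thesis by (auto simp: minus_one_power_iff)
  qed auto
  have "brW p r n t D E k c = (\<Sum>i\<in>Iall r n. \<Sum>j\<in>Iall r n. \<Sum>a\<in>BB. \<Sum>b\<in>BB.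
      (if k = j then D i a * E j b * (mono a \<star> dd i (mono b)) c else 0) -
      (if k = i then D i a * E j b * (mono b \<star> dd j (mono a)) c else 0))"
    unfolding brW_def bracket_basis_def by (intro sum.cong refl) (auto simp: right_diff_distrib sgn)
  also have "\<dots> = (\<Sum>i\<in>Iall r n. \<Sum>j\<in>Iall r n.
      (if k = j then (\<Sum>a\<in>BB. \<Sum>b\<in>BB. D i a * E j b * (mono a \<star> dd i (mono b)) c) else 0) -
      (if k = i then (\<Sum>a\<in>BB. \<Sum>b\<in>BB. D i a * E j b * (mono b \<star> dd j (mono a)) c) else 0))"
    by (intro sum.cong refl) (auto simp: sum_subtractf)
  also have "\<dots> = (\<Sum>i\<in>Iall r n. \<Sum>j\<in>Iall r n.
      (if k = j then (D i \<star> dd i (E j)) c else 0) - (if k = i then (E j \<star> dd j (D i)) c else 0))"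
    by (simp only: Omult_dpart_expand [symmetric] Omult_dpart_expand_swap)
  also have "\<dots> = (\<Sum>i\<in>Iall r n. \<Sum>j\<in>Iall r n. if k = j then (D i \<star> dd i (E j)) c else 0) -
      (\<Sum>j\<in>Iall r n. \<Sum>i\<in>Iall r n. if k = i then (E j \<star> dd j (D i)) c else 0)"
    unfolding sum_subtractf by (subst (2) sum.swap) (rule refl)
  also have "\<dots> = act D (E k) c - act E (D k) c"
    using k by (simp add: act_def)
  finally show ?thesis .
qed

lemma act_scale: "act D (\<lambda>c. s * g c) c = s * act D g c"
  unfolding act_def dpart_scale [abs_def] Omult_scale_right sum_distrib_left ..

lemma act_DH:
  "act (DH p r n t q f) g c =
    (\<Sum>j\<in>Iall r n. tauI r j * (-1) ^ (muI r n j * q) * (dd j f \<star> dd (primeI r n j) g) c)"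
proof -
  have "act (DH p r n t q f) g c = (\<Sum>j\<in>Iall r n. tauI r (primeI r n j) * (-1) ^ (muI r n (primeI r n j) * q) *
     (dd (primeI r n j) f \<star> dd (primeI r n (primeI r n j)) g) c)"
    unfolding act_def by (intro sum.cong refl) (simp add: DH_eq [abs_def] Omult_scale_left)
  then show ?thesis
    using sum_primeI [where S = "Iall r n" and r = r and n = n
        and h = "\<lambda>j. tauI r j * (-1) ^ (muI r n j * q) * (dd j f \<star> dd (primeI r n j) g) c"] by simp
qed

lemma even_field_DH: "homog 0 f \<Longrightarrow> even_field (DH p r n t 0 f)"
  unfolding even_field_def
proof
  fix k assume f: "homog 0 f" and k: "k \<in> Iall r n"
  have "homog (muI r n k) (dd (primeI r n k) f)" using homog_dpart [OF f, of r n "primeI r n k"] by simp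
  then show "homog (muI r n k) (DH p r n t 0 f k)" using k by (simp add: DH_eq [abs_def] homog_scale)
qed

lemma homog_pb:
  assumes "homog 0 f" "homog q g" shows "homog q (pb f g)"
proof -
  have "homog q (dd j f \<star> dd (primeI r n j) g)" for j
    using homog_Omult [OF homog_dpart [OF assms(1), of r n j] homog_dpart [OF assms(2), of r n "primeI r n j"]]
    by (rule homog_cong_parity) (simp add: muI_def)
  then show ?thesis unfolding pb_def by (intro homog_sum homog_scale)
qed

text \<open>In the component k put i = k'. Apart from a constant, the bracket is the sum of
  \<open>tauI r j\<close> times \<open>?X j\<close> and \<open>?Y j\<close>, where d_i falls on the
  g-factor or on the f-factor. By the Leibniz rule this is d_i of the Poisson bracket.\<close>

lemma brW_DH:
  assumes f: "homog 0 f" and g: "homog q g"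
  shows "brW p r n t (DH p r n t 0 f) (DH p r n t q g) = DH p r n t q (pb f g)"
proof (intro ext)
  fix k c
  show "brW p r n t (DH p r n t 0 f) (DH p r n t q g) k c = DH p r n t q (pb f g) k c"
  proof (cases "k \<in> Iall r n")
    case True
    define i where "i = primeI r n k"
    have i: "i \<in> Iall r n" and mu: "muI r n i = muI r n k" using True by (simp_all add: i_def primeI_Iall)
    define C :: 'a where "C = tauI r i * (-1) ^ (muI r n i * q)"
    let ?X = "\<lambda>j. (dd j f \<star> dd (primeI r n j) (dd i g)) c"
    let ?Y = "\<lambda>j. (dd i (dd j f) \<star> dd (primeI r n j) g) c"
    have DHg: "DH p r n t q g k = (\<lambda>c. C * dd i g c)"
      using True by (simp add: DH_eq [abs_def] C_def i_def)
    have DHf: "DH p r n t 0 f k = (\<lambda>c. tauI r i * dd i f c)"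
      using True by (simp add: DH_eq [abs_def] i_def)
    have X: "act (DH p r n t 0 f) (DH p r n t q g k) c = C * (\<Sum>j\<in>Iall r n. tauI r j * ?X j)"
      unfolding DHg act_scale act_DH by simp
    have "act (DH p r n t q g) (DH p r n t 0 f k) c = tauI r i *
        (\<Sum>j\<in>Iall r n. tauI r j * (-1) ^ (muI r n j * q) * (dd j g \<star> dd (primeI r n j) (dd i f)) c)"
      unfolding DHf act_scale act_DH ..
    \<comment> \<open>Replacing j by j' puts d_j on f and d_j' on g, as in
      \<open>?X\<close>.\<close>
    also have "\<dots> = tauI r i * (\<Sum>j\<in>Iall r n. tauI r (primeI r n j) * (-1) ^ (muI r n j * q) *
        (dd (primeI r n j) g \<star> dd j (dd i f)) c)"
      using sum_primeI [where S = "Iall r n" and r = r and n = n and h = "\<lambda>j. tauI r j * (-1) ^ (muI r n j * q) *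
        (dd j g \<star> dd (primeI r n j) (dd i f)) c"] by simp
    also have "\<dots> = tauI r i * (\<Sum>j\<in>Iall r n. - ((-1) ^ (muI r n i * q)) * (tauI r j * ?Y j))"
    proof (rule arg_cong2 [where f = "(*)", OF refl sum.cong [OF refl]])
      fix j assume j: "j \<in> Iall r n"
      \<comment> \<open>The factors are exchanged at the price of a sign; the next step exchanges
        the two derivatives on f.\<close>
      have 1: "(dd (primeI r n j) g \<star> dd j (dd i f)) c =
          (-1) ^ ((muI r n j + q) * (muI r n j + muI r n i)) * (dd j (dd i f) \<star> dd (primeI r n j) g) c"
        by (rule Omult_commute) (use homog_dpart [OF g, of r n "primeI r n j"]
          homog_dpart [OF homog_dpart [OF f, of r n i], of r n j] in simp_all)
      have 2: "(dd j (dd i f) \<star> dd (primeI r n j) g) c = (-1) ^ (muI r n j * muI r n i) * ?Y j"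
        unfolding dpart_commute [of p r n t j i, abs_def] Omult_scale_left ..
      show "tauI r (primeI r n j) * (-1) ^ (muI r n j * q) * (dd (primeI r n j) g \<star> dd j (dd i f)) c =
         - ((-1) ^ (muI r n i * q)) * (tauI r j * ?Y j)"
        unfolding 1 2 tauI_primeI [OF j] by (auto simp: muI_def minus_one_power_iff)
    qed
    also have "\<dots> = - C * (\<Sum>j\<in>Iall r n. tauI r j * ?Y j)"
      unfolding C_def by (simp add: sum_distrib_left [symmetric] sum_negf)
    finally have Y: "act (DH p r n t q g) (DH p r n t 0 f k) c = - C * (\<Sum>j\<in>Iall r n. tauI r j * ?Y j)" .
    \<comment> \<open>The sign of the Leibniz rule cancels against that of exchanging d_i and d_j',
      as j and j' have the same parity.\<close>
    have Z: "dd i (dd j f \<star> dd (primeI r n j) g) c = ?Y j + ?X j" if "j \<in> Iall r n" for j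
    proof -
      have "dd i (dd j f \<star> dd (primeI r n j) g) c =
          ?Y j + (-1) ^ (muI r n i * muI r n j) * (dd j f \<star> dd i (dd (primeI r n j) g)) c"
        using Leibniz [OF i homog_dpart [OF f, of r n j]] by simp
      also have "(dd j f \<star> dd i (dd (primeI r n j) g)) c = (-1) ^ (muI r n i * muI r n j) * ?X j"
        unfolding dpart_commute [of p r n t i "primeI r n j", abs_def] Omult_scale_right by simp
      finally show ?thesis by (simp add: muI_def)
    qed
    have "DH p r n t q (pb f g) k c = C * (\<Sum>j\<in>Iall r n. tauI r j * dd i (dd j f \<star> dd (primeI r n j) g) c)"
      using True by (simp add: DH_eq C_def mu flip: i_def) (simp add: pb_def dpart_sum dpart_scale)
    also have "\<dots> = C * (\<Sum>j\<in>Iall r n. tauI r j * ?X j) + C * (\<Sum>j\<in>Iall r n. tauI r j * ?Y j)"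
      by (simp add: Z algebra_simps sum.distrib)
    finally show ?thesis
      using True even_field_DH [OF f] by (simp add: brW_even_field X Y)
  qed (simp add: brW_outside DH_eq)
qed

section \<open>Total derivatives and missing top coefficients\<close>

lemma sum_tauI_dpart_dpart:
  assumes S: "S = I0 r \<or> S = I1 r n"
  shows "(\<Sum>j\<in>S. tauI r j * dd j (dd (primeI r n j) g) c) = 0"
proof (rule eq_minus_self_zero)
  have "S \<subseteq> Iall r n" using S by (auto simp: Iall_def)
  have S': "S = I0 r \<or> S = I1 r n \<or> S = Iall r n" using S by blast
  have "(\<Sum>j\<in>S. tauI r j * dd j (dd (primeI r n j) g) c) =
      (\<Sum>j\<in>S. tauI r (primeI r n j) * dd (primeI r n j) (dd j g) c)"
    using sum_primeI [OF S', where h = "\<lambda>j. tauI r j * dd j (dd (primeI r n j) g) c"] by simp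
  \<comment> \<open>Exchanging the two derivatives reverses the sign of each term: for even j
    through tau, for odd j through anticommutation. The sum is thus its own negative.\<close>
  also have "\<dots> = (\<Sum>j\<in>S. - (tauI r j * dd j (dd (primeI r n j) g) c))"
  proof (intro sum.cong refl)
    fix j assume "j \<in> S"
    then have j: "j \<in> Iall r n" using \<open>S \<subseteq> Iall r n\<close> by blast
    show "tauI r (primeI r n j) * dd (primeI r n j) (dd j g) c = - (tauI r j * dd j (dd (primeI r n j) g) c)"
      unfolding dpart_commute [of p r n t "primeI r n j" j] tauI_primeI [OF j] by (simp add: muI_def)
  qed
  finally show "(\<Sum>j\<in>S. tauI r j * dd j (dd (primeI r n j) g) c) =
      - (\<Sum>j\<in>S. tauI r j * dd j (dd (primeI r n j) g) c)" by (simp add: sum_negf)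
qed

lemma sum_Iall: "(\<Sum>j\<in>Iall r n. h j) = (\<Sum>j\<in>I0 r. h j) + (\<Sum>j\<in>I1 r n. h j)"
  unfolding Iall_def by (rule sum.union_disjoint) (auto dest: I0_I1_disjoint)

text \<open>Integration by parts: the remaining term is f times the sum of tau(j) d_j d_j' g, which
  vanishes.\<close>

lemma sum_pb_total_derivative:
  assumes S: "S = I0 r \<or> S = I1 r n" and f: "homog 0 f"
  shows "(\<Sum>j\<in>S. tauI r j * (dd j f \<star> dd (primeI r n j) g) c) =
    (\<Sum>j\<in>S. tauI r j * dd j (f \<star> dd (primeI r n j) g) c)"
proof -
  have SI: "S \<subseteq> Iall r n" using S by (auto simp: Iall_def)
  have "(\<Sum>j\<in>S. tauI r j * dd j (f \<star> dd (primeI r n j) g) c) =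
     (\<Sum>j\<in>S. tauI r j * (dd j f \<star> dd (primeI r n j) g) c) +
     (f \<star> (\<lambda>c. \<Sum>j\<in>S. tauI r j * dd j (dd (primeI r n j) g) c)) c"
    using SI unfolding Omult_sum_right Omult_scale_right sum.distrib [symmetric]
    by (intro sum.cong refl) (simp add: Leibniz [OF _ f] subset_iff distrib_left)
  then show ?thesis unfolding sum_tauI_dpart_dpart [OF S] by simp
qed

lemma dpart_I0_top: "j \<in> I0 r \<Longrightarrow> dd j f (pie, v) = 0"
  unfolding dpart_I0 Basis_iff Aset_def by (auto dest: spec [of _ j])

lemma dpart_I1_top: "j \<in> I1 r n \<Longrightarrow> dd j f (\<gamma>, omega r n) = 0"
  by (simp add: dpart_I1 omega_def)

text \<open>No even derivative reaches the exponent pi, and no odd derivative reaches all of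
  omega.\<close>

lemma pb_pi_omega:
  assumes f: "homog 0 f" shows "pb f g (pie, omega r n) = 0"
  unfolding pb_def sum_Iall sum_pb_total_derivative [OF disjI1 [OF refl] f] sum_pb_total_derivative [OF disjI2 [OF refl] f]
  by (simp add: dpart_I0_top dpart_I1_top)

text \<open>The even indices give total derivatives. For odd j the factor d_j f is odd, so it has no
  term free of odd variables.\<close>

lemma pb_pi_empty:
  assumes f: "homog 0 f" shows "pb f g (pie, {}) = 0"
proof -
  have "(dd j f \<star> h) (pie, {}) = 0" if j: "j \<in> I1 r n" for j h
    unfolding Omult_expand
  proof (intro sum.neutral ballI)
    fix a b :: bidx
    obtain \<alpha> u \<beta> v where e: "a = (\<alpha>, u)" "b = (\<beta>, v)" by (cases a; cases b)
    have "dd j f (\<alpha>, {}) = 0"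
      using homog_dpart [OF f, of r n j] j by (force simp: homog_def muI_def)
    then show "dd j f a * h b * M a b (pie, {}) = 0"
      using mult_basis_nonzeroD(2) [of p r t \<alpha> u \<beta> v pie "{}"] by (cases "u = {}") (auto simp: e)
  qed
  then show ?thesis
    unfolding pb_def sum_Iall sum_pb_total_derivative [OF disjI1 [OF refl] f]
    by (simp add: dpart_I0_top)
qed

text \<open>Each monomial of an odd element contains an odd variable, which already occurs in
  x^omega.\<close>

lemma Omult_omega:
  assumes "homog 1 f" shows "(f \<star> mono (\<lambda>_. 0, omega r n)) c = 0"
  unfolding Omult_expand
proof (intro sum.neutral ballI)
  fix a b :: bidx assume "a \<in> BB"
  obtain \<alpha> u \<beta> v \<gamma> w where e: "a = (\<alpha>, u)" "b = (\<beta>, v)" "c = (\<gamma>, w)" by (cases a; cases b; cases c)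
  have u: "u \<subseteq> omega r n" using \<open>a \<in> BB\<close> by (simp add: e Basis_iff omega_def)
  have "f (\<alpha>, {}) = 0" using assms by (force simp: homog_def)
  then show "f a * mono (\<lambda>_. 0, omega r n) b * M a b c = 0"
    using mult_basis_nonzeroD(1) [of p r t \<alpha> u \<beta> v \<gamma> w] u
    by (cases "u = {}") (auto simp: e mono_def)
qed

lemma zero_omega_Basis [simp]: "(\<lambda>_. 0, omega r n) \<in> BB"
  by (simp add: Basis_iff omega_def Aset_def)

text \<open>Even derivatives kill x^omega. For odd j, differentiating d_j f * x^omega = 0 by d_j'
  moves the derivative onto d_j f; the resulting sum of d_j' d_j f is zero.\<close>

lemma pb_omega:
  assumes f: "homog 0 f"
  shows "pb f (mono (\<lambda>_. 0, omega r n)) c = 0"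
proof -
  let ?w = "mono (\<lambda>_. 0, omega r n)"
  have "dd j ?w = (\<lambda>c. 0)" if "j \<in> I0 r" for j
    using that by (simp add: fun_eq_iff dpart_mono dpart_basis_I0)
  then have "(\<Sum>j\<in>I0 r. tauI r j * (dd j f \<star> dd (primeI r n j) ?w) c) = 0"
    using primeI_I0 by simp
  moreover have "(dd j f \<star> dd (primeI r n j) ?w) c = (dd (primeI r n j) (dd j f) \<star> ?w) c" if j: "j \<in> I1 r n" for j
  proof -
    have h: "homog 1 (dd j f)" using homog_dpart [OF f, of r n j] j by (simp add: muI_def)
    have "dd (primeI r n j) (dd j f \<star> ?w) c = 0" unfolding Omult_omega [OF h, abs_def] by simp
    moreover have "dd (primeI r n j) (dd j f \<star> ?w) c =
        (dd (primeI r n j) (dd j f) \<star> ?w) c + (-1) ^ (muI r n (primeI r n j) * 1) * (dd j f \<star> dd (primeI r n j) ?w) c"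
      by (rule Leibniz [OF _ h]) (simp add: j primeI_I1 Iall_def)
    ultimately show ?thesis using j by (simp add: muI_def)
  qed
  then have "(\<Sum>j\<in>I1 r n. tauI r j * (dd j f \<star> dd (primeI r n j) ?w) c) =
     ((\<lambda>c. \<Sum>j\<in>I1 r n. dd (primeI r n j) (dd j f) c) \<star> ?w) c"
    unfolding Omult_sum_left by (intro sum.cong refl) (simp add: tauI_I1)
  moreover have "(\<Sum>j\<in>I1 r n. dd (primeI r n j) (dd j f) c) = 0" for c
    using sum_tauI_dpart_dpart [of "I1 r n" f c]
      sum_primeI [of "I1 r n" r n "\<lambda>j. dd (primeI r n j) (dd j f) c"]
    by (simp add: tauI_I1 cong: sum.cong)
  ultimately show ?thesis unfolding pb_def sum_Iall by simp
qed

end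

section \<open>The centraliser of the ideal in the odd part\<close>

text \<open>The only unpaired odd index is the last one, and it exists only when n is odd.\<close>

lemma primeI_fixed_I1:
  assumes "i \<in> I1 r n" "primeI r n i = i" shows "odd n" "i = 2*r + n"
proof -
  have "i \<noteq> 0" "2*r < i" "i \<le> 2*r + n" using assms(1) by (auto simp: I1_def)
  then have "i > 2*r + 2 * (n div 2)" using assms(2)
    by (auto simp: primeI_def Let_def split: if_splits)
  with \<open>i \<le> 2*r + n\<close> show "odd n" "i = 2*r + n" by presburger+
qed

lemma primeI_last: "odd n \<Longrightarrow> 0 < r \<Longrightarrow> primeI r n (2*r + n) = 2*r + n"
proof -
  assume "odd n" "0 < r"
  then have "n = 2 * (n div 2) + 1" by presburger
  then have "\<not> 2*r + n \<le> 2*r + 2 * (n div 2)" "\<not> 2*r + n \<le> 2*r + n div 2" by linarith+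
  then show ?thesis using \<open>0 < r\<close> by (simp add: primeI_def Let_def)
qed

context ham
begin

abbreviation zero_exp :: "nat \<Rightarrow> nat" where "zero_exp \<equiv> \<lambda>_. 0"

lemma pie_ge: "i \<in> I0 r \<Longrightarrow> 3 \<le> pie i"
proof -
  assume i: "i \<in> I0 r"
  have "p ^ 1 \<le> p ^ t i" using t_pos [OF i] p_gt by (intro power_increasing) auto
  then show ?thesis using i p_gt by (simp add: piv_def)
qed

lemma zero_exp_Aset: "zero_exp \<in> Aset p r t"
  by (simp add: Aset_def)

lemma single_Aset: "i \<in> I0 r \<Longrightarrow> a \<le> 2 \<Longrightarrow> zero_exp(i := a) \<in> Aset p r t"
  using pie_ge by (force simp: Aset_def)

text \<open>Every bound pi_i is at least 3, so one even exponent of size at most 2 rules out both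
  excluded monomials, x^pi x^omega and x^pi.\<close>

lemma genJ_I:
  assumes "\<alpha> \<in> Aset p r t" "i \<in> I0 r" "\<alpha> i \<le> 2" "u \<subseteq> I1 r n" "even (card u)"
  shows "(\<alpha>, u) \<in> genJ p r n t"
proof -
  have "\<alpha> \<noteq> pie" using pie_ge [OF assms(2)] assms(3) by auto
  then show ?thesis using assms by (simp add: genJ_def genH_def B0set_def Bset_def)
qed

lemma one_mem_I0: "Suc 0 \<in> I0 r"
  using r_pos by (simp add: I0_def)

section \<open>Products with generators and derivatives of small monomials\<close>

lemma Omult_one_left: "c \<in> BB \<Longrightarrow> (mono (zero_exp, {}) \<star> g) c = g c"
proof -
  assume c: "c \<in> BB"
  have "(mono (zero_exp, {}) \<star> g) c = (\<Sum>b\<in>BB. g b * M (zero_exp, {}) b c)"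
    by (subst Omult_expand_right) (simp add: Omult_mono Basis_iff zero_exp_Aset)
  also have "\<dots> = (\<Sum>b\<in>BB. if b = c then g b else 0)"
    using c by (intro sum.cong refl) (auto simp: mult_basis_eq Basis_iff split: prod.splits)
  finally show ?thesis using c by simp
qed

lemma Omult_one_right: "c \<in> BB \<Longrightarrow> (f \<star> mono (zero_exp, {})) c = f c"
proof -
  assume c: "c \<in> BB"
  have "(f \<star> mono (zero_exp, {})) c = (\<Sum>b\<in>BB. f b * M b (zero_exp, {}) c)"
    by (subst Omult_expand_left) (simp add: Omult_mono Basis_iff zero_exp_Aset)
  also have "\<dots> = (\<Sum>b\<in>BB. if b = c then f b else 0)"
    using c by (intro sum.cong refl) (auto simp: mult_basis_eq Basis_iff split: prod.splits)
  finally show ?thesis using c by simp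
qed

lemma Omult_generator:
  assumes b: "b \<in> I1 r n"
  shows "(mono (zero_exp, {b}) \<star> f) (\<gamma>, v) =
    (if b \<in> v \<and> (\<gamma>, v) \<in> BB then ins_sgn b (v - {b}) * f (\<gamma>, v - {b}) else 0)"
proof (cases "(\<gamma>, v) \<in> BB")
  case True
  then have mem: "\<gamma> \<in> Aset p r t" "v \<subseteq> I1 r n" "(\<gamma>, v - {b}) \<in> BB" by (auto simp: Basis_iff)
  have "(mono (zero_exp, {b}) \<star> f) (\<gamma>, v) = (\<Sum>a\<in>BB. f a * M (zero_exp, {b}) a (\<gamma>, v))"
    using b by (subst Omult_expand_right) (simp add: Omult_mono Basis_iff zero_exp_Aset)
  also have "\<dots> = (\<Sum>a\<in>BB. if a = (\<gamma>, v - {b}) then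
      if b \<in> v then ins_sgn b (v - {b}) * f (\<gamma>, v - {b}) else 0 else 0)"
  proof (intro sum.cong refl)
    fix a assume a: "a \<in> BB"
    obtain \<alpha> u where e: "a = (\<alpha>, u)" by (cases a)
    have "finite u" using a e finite_Basis_snd by blast
    moreover have "b \<notin> u \<and> v = insert b u \<longleftrightarrow> b \<in> v \<and> u = v - {b}" by auto
    ultimately show "f a * M (zero_exp, {b}) a (\<gamma>, v) = (if a = (\<gamma>, v - {b}) then
      if b \<in> v then ins_sgn b (v - {b}) * f (\<gamma>, v - {b}) else 0 else 0)"
      using mem by (auto simp: e mult_basis_eq sgn_uv_singleton_left)
  qed
  finally show ?thesis using True mem by simp
qed (simp add: Omult_outside_Basis)

lemma dpart_single:
  assumes i: "i \<in> I0 r" and a: "a \<le> 2" and u: "u \<subseteq> I1 r n"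
    and j: "j \<in> I0 r"
  shows "dd j (mono (zero_exp(i := a), u)) =
    (if j = i \<and> 1 \<le> a then mono (zero_exp(i := a - 1), u) else (\<lambda>c. 0))"
  using j u single_Aset [OF i a]
  by (intro ext) (auto simp: dpart_mono dpart_basis_I0 Basis_iff)

lemma dpart_pure_I1:
  assumes "\<alpha> \<in> Aset p r t" "j \<in> I1 r n"
  shows "dd j (mono (\<alpha>, {})) = (\<lambda>c. 0)"
  using assms by (intro ext) (simp add: dpart_mono dpart_basis_I1 Basis_iff)

lemma dpart_pair:
  assumes \<alpha>: "\<alpha> \<in> Aset p r t" and ab: "a \<in> I1 r n" "b \<in> I1 r n" "a < b" and j: "j \<in> I1 r n"
  shows "dd j (mono (\<alpha>, {a, b})) = (\<lambda>c. if j = a then mono (\<alpha>, {b}) c else if j = b then - mono (\<alpha>, {a}) c else 0)"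
proof -
  have "{a, b} - {a} = {b}" "{a, b} - {b} = {a}" using ab by auto
  then show ?thesis using assms
    by (intro ext) (auto simp: dpart_mono dpart_basis_I1 Basis_iff ins_sgn_insert)
qed

lemma dpart_zero_exp:
  assumes "u \<subseteq> I1 r n" "j \<in> I0 r" shows "dd j (mono (zero_exp, u)) = (\<lambda>c. 0)"
  using assms by (intro ext) (simp add: dpart_mono dpart_basis_I0 Basis_iff zero_exp_Aset)

lemma dpart_generator:
  assumes "b \<in> I1 r n" "j \<in> Iall r n"
  shows "dd j (mono (zero_exp, {b})) = (if j = b then mono (zero_exp, {}) else (\<lambda>c. 0))"
proof (cases "j \<in> I0 r")
  case True
  then show ?thesis using assms dpart_zero_exp [of "{b}" j] by (auto dest: I0_I1_disjoint)
next
  case False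
  then show ?thesis using assms
    by (intro ext) (auto simp: Iall_def dpart_mono dpart_basis_I1 Basis_iff zero_exp_Aset ins_sgn_def)
qed

section \<open>Odd fields commuting with the generators of J\<close>

definition centralises_J :: "'a Wel \<Rightarrow> bool" where
  "centralises_J E \<longleftrightarrow> E \<in> W1 p r n t \<and> (\<forall>a\<in>genJ p r n t. brW p r n t (DH p r n t 0 (mono a)) E = (\<lambda>k c. 0))"

lemma W1_outside: "E \<in> W1 p r n t \<Longrightarrow> c \<notin> BB \<Longrightarrow> E k c = 0"
  unfolding W1_def by blast

lemma W1_index: "E \<in> W1 p r n t \<Longrightarrow> E k c \<noteq> 0 \<Longrightarrow> k \<in> Iall r n"
  unfolding W1_def by blast

text \<open>The component k of [D_H(x^a), E] = 0: the field D_H(x^a) applied to E_k equals E applied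
  to the k-th coefficient of D_H(x^a). All later restrictions on E come from choosing a and k
  here.\<close>

lemma centraliser_eq:
  assumes E: "centralises_J E" and a: "a \<in> genJ p r n t" and k: "k \<in> Iall r n"
  shows "(\<Sum>j\<in>Iall r n. tauI r j * (dd j (mono a) \<star> dd (primeI r n j) (E k)) c) =
    tauI r (primeI r n k) * (\<Sum>j\<in>Iall r n. (E j \<star> dd j (dd (primeI r n k) (mono a))) c)"
proof -
  have "even (card (snd a))" using a by (auto simp: genJ_def genH_def B0set_def)
  then have "homog 0 (mono a :: 'a Oel)" using homog_cong_parity [OF homog_mono, of a 0] by simp
  moreover from E a have "brW p r n t (DH p r n t 0 (mono a)) E k c = 0" by (simp add: centralises_J_def)
  moreover have "DH p r n t 0 (mono a) k = (\<lambda>c. tauI r (primeI r n k) * dd (primeI r n k) (mono a) c)"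
    using k by (simp add: DH_eq [abs_def])
  ultimately have "act (DH p r n t 0 (mono a)) (E k) c =
      tauI r (primeI r n k) * act E (dd (primeI r n k) (mono a)) c"
    using k by (simp add: brW_even_field even_field_DH act_scale)
  then show ?thesis unfolding act_DH by (simp add: act_def)
qed

lemma sum_single:
  assumes "finite S" "i \<in> S" "\<And>j. j \<in> S \<Longrightarrow> j \<noteq> i \<Longrightarrow> h j = 0"
  shows "(\<Sum>j\<in>S. h j) = (h i :: 'a)"
  using assms by (subst sum.remove [of S i]) (auto intro!: sum.neutral)

lemma centraliser_dpart_zero:
  assumes E: "centralises_J E" and i: "i \<in> I0 r"
  shows "dd i (E k) = (\<lambda>c. 0)"
proof
  fix c
  \<comment> \<open>The index is primed because D_H(x_i') is a multiple of d_i; its coefficients are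
    constant, so E annihilates them.\<close>
  let ?i = "primeI r n i" and ?a = "(zero_exp(primeI r n i := Suc 0), {}) :: bidx"
  have i': "?i \<in> I0 r" using i by (rule primeI_I0)
  have a: "?a \<in> genJ p r n t" using i' single_Aset [OF i', of "Suc 0"] by (intro genJ_I [OF _ i']) auto
  have d: "dd j (mono ?a) = (if j = ?i then mono (zero_exp, {}) else (\<lambda>c. 0))" if "j \<in> Iall r n" for j
    using that dpart_single [OF i', of "Suc 0" "{}" j] dpart_pure_I1 [OF single_Aset [OF i', of "Suc 0"], of j] i'
    by (auto simp: Iall_def fun_upd_idem dest: I0_I1_disjoint)
  have z: "dd j (mono (zero_exp, {})) = (\<lambda>c. 0)" if "j \<in> Iall r n" for j
    using that dpart_zero_exp [of "{}" j] dpart_pure_I1 [OF zero_exp_Aset, of j] by (auto simp: Iall_def)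
  have II: "?i \<in> Iall r n" using i' by (simp add: Iall_def)
  consider "k \<notin> Iall r n" | "c \<notin> BB" | "k \<in> Iall r n" "c \<in> BB" by blast
  then show "dd i (E k) c = 0"
  proof cases
    case 1
    then have "E k = (\<lambda>c. 0)" using E W1_index unfolding centralises_J_def by blast
    then show ?thesis by simp
  next
    case 3
    have "(\<Sum>j\<in>Iall r n. (E j \<star> dd j (dd (primeI r n k) (mono ?a))) c) = 0"
      using 3 by (intro sum.neutral ballI) (simp add: d z primeI_Iall)
    then have "(\<Sum>j\<in>Iall r n. tauI r j * (dd j (mono ?a) \<star> dd (primeI r n j) (E k)) c) = 0"
      unfolding centraliser_eq [OF E a 3(1)] by simp
    also have "(\<Sum>j\<in>Iall r n. tauI r j * (dd j (mono ?a) \<star> dd (primeI r n j) (E k)) c) =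
        tauI r ?i * (dd ?i (mono ?a) \<star> dd (primeI r n ?i) (E k)) c"
      by (rule sum_single) (use II in \<open>simp_all add: d\<close>)
    finally show ?thesis using 3 II by (simp add: d Omult_one_left)
  qed (simp add: dpart_outside_Basis)
qed

text \<open>All even derivatives of E_k vanish, and d_i only shifts the exponent of a divided power,
  so a term with a positive exponent would survive under d_i.\<close>

lemma centraliser_constant:
  assumes E: "centralises_J E" and nz: "E k (\<gamma>, v) \<noteq> 0"
  shows "\<gamma> = zero_exp"
proof
  have mem: "(\<gamma>, v) \<in> BB" using E nz W1_outside unfolding centralises_J_def by blast
  fix i show "\<gamma> i = 0"
  proof (cases "i \<in> I0 r")
    case True
    show ?thesis
    proof (rule ccontr)
      assume "\<gamma> i \<noteq> 0"
      then have "(\<gamma>(i := \<gamma> i - 1))(i := Suc ((\<gamma>(i := \<gamma> i - 1)) i)) = \<gamma>" by auto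
      then have "dd i (E k) (\<gamma>(i := \<gamma> i - 1), v) = E k (\<gamma>, v)"
        using mem by (simp only: dpart_I0 [OF True] if_True)
      then show False using nz centraliser_dpart_zero [OF E True, of k] by simp
    qed
  next
    case False
    then show ?thesis using mem Aset_outside by (auto simp: Basis_iff)
  qed
qed

text \<open>D_H(x^(2 eps_i)) is a multiple of x_i d_i'. As d_i' kills the coefficients of E, the
  component i' of the bracket leaves E(x_i) = E_i.\<close>

lemma centraliser_I0:
  assumes E: "centralises_J E" and i: "i \<in> I0 r"
  shows "E i = (\<lambda>c. 0)"
proof
  fix c
  let ?a = "(zero_exp(i := 2), {}) :: bidx"
  have a: "?a \<in> genJ p r n t" using i single_Aset [OF i, of 2] by (intro genJ_I [OF _ i]) auto
  have d: "dd j (mono ?a) = (if j = i then mono (zero_exp(i := Suc 0), {}) else (\<lambda>c. 0))" if "j \<in> Iall r n" for j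
    using that dpart_single [OF i, of 2 "{}" j] dpart_pure_I1 [OF single_Aset [OF i, of 2], of j] i
    by (auto simp: Iall_def dest: I0_I1_disjoint)
  have d1: "dd j (mono (zero_exp(i := Suc 0), {})) = (if j = i then mono (zero_exp, {}) else (\<lambda>c. 0))" if "j \<in> Iall r n" for j
    using that dpart_single [OF i, of "Suc 0" "{}" j] dpart_pure_I1 [OF single_Aset [OF i, of "Suc 0"], of j] i
    by (auto simp: Iall_def fun_upd_idem dest: I0_I1_disjoint)
  have I: "i \<in> Iall r n" "primeI r n i \<in> Iall r n" using i primeI_I0 by (auto simp: Iall_def)
  show "E i c = 0"
  proof (cases "c \<in> BB")
    case True
    have "(\<Sum>j\<in>Iall r n. tauI r j * (dd j (mono ?a) \<star> dd (primeI r n j) (E (primeI r n i))) c) = 0"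
    proof (intro sum.neutral ballI)
      fix j assume "j \<in> Iall r n"
      then show "tauI r j * (dd j (mono ?a) \<star> dd (primeI r n j) (E (primeI r n i))) c = 0"
        using centraliser_dpart_zero [OF E primeI_I0 [OF i]] by (cases "j = i") (simp_all add: d)
    qed
    then have "(\<Sum>j\<in>Iall r n. (E j \<star> dd j (dd i (mono ?a))) c) = 0"
      using centraliser_eq [OF E a I(2), of c] by simp
    also have "(\<Sum>j\<in>Iall r n. (E j \<star> dd j (dd i (mono ?a))) c) = (E i \<star> dd i (dd i (mono ?a))) c"
      by (rule sum_single) (use I in \<open>simp_all add: d d1\<close>)
    finally show ?thesis using True I by (simp add: d d1 Omult_one_right)
  next
    case False
    then show ?thesis using E W1_outside unfolding centralises_J_def by blast
  qed
qed

lemma centraliser_index: "centralises_J E \<Longrightarrow> E k c \<noteq> 0 \<Longrightarrow> k \<in> I1 r n"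
  using centraliser_I0 [of E k] W1_index [of E k c] by (auto simp: centralises_J_def Iall_def)

lemma centraliser_homog:
  assumes "centralises_J E" "a \<in> I1 r n" shows "homog 0 (E a)"
  using assms by (auto simp: centralises_J_def W1_def homog_def muI_def)

text \<open>Equivalent to \<open>E(x\<^sub>a x\<^sub>b) = 0\<close>: the \<open>\<partial>\<^bsub>1'\<^esub>\<close>-component of \<open>[D\<^sub>H(x\<^sub>1 x\<^sub>a x\<^sub>b), E]\<close>.\<close>

lemma centraliser_product_less:
  assumes E: "centralises_J E" and ab: "a \<in> I1 r n" "b \<in> I1 r n" "a < b"
  shows "(mono (zero_exp, {b}) \<star> E a) c = (mono (zero_exp, {a}) \<star> E b) c"
proof -
  let ?a = "(zero_exp(Suc 0 := Suc 0), {a, b}) :: bidx" and ?k = "primeI r n (Suc 0)"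
  note i = one_mem_I0
  have sub: "{a, b} \<subseteq> I1 r n" using ab by simp
  have a: "?a \<in> genJ p r n t" using ab single_Aset [OF i, of "Suc 0"] by (intro genJ_I [OF _ i]) auto
  have k: "?k \<in> I0 r" "?k \<in> Iall r n" using i primeI_I0 by (auto simp: Iall_def)
  have d: "dd (Suc 0) (mono ?a) = mono (zero_exp, {a, b})"
    using dpart_single [OF i _ sub i, of "Suc 0"] by (simp add: fun_upd_idem)
  have "(\<Sum>j\<in>Iall r n. tauI r j * (dd j (mono ?a) \<star> dd (primeI r n j) (E ?k)) c) = 0"
    unfolding centraliser_I0 [OF E k(1)] by simp
  then have "(\<Sum>j\<in>Iall r n. (E j \<star> dd j (mono (zero_exp, {a, b}))) c) = 0"
    using centraliser_eq [OF E a k(2), of c] by (simp add: d)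
  then have "(\<Sum>j\<in>I1 r n. (E j \<star> dd j (mono (zero_exp, {a, b}))) c) = 0"
    unfolding sum_Iall by (simp add: centraliser_I0 [OF E])
  also have "(\<Sum>j\<in>I1 r n. (E j \<star> dd j (mono (zero_exp, {a, b}))) c) =
      (\<Sum>j\<in>I1 r n. (if j = a then (E a \<star> mono (zero_exp, {b})) c else 0) -
        (if j = b then (E b \<star> mono (zero_exp, {a})) c else 0))"
  proof (intro sum.cong refl)
    fix j assume j: "j \<in> I1 r n"
    show "(E j \<star> dd j (mono (zero_exp, {a, b}))) c = (if j = a then (E a \<star> mono (zero_exp, {b})) c else 0) -
        (if j = b then (E b \<star> mono (zero_exp, {a})) c else 0)"
      unfolding dpart_pair [OF zero_exp_Aset ab j]
      using ab Omult_scale_right [of p r n t "E b" "-1" "mono (zero_exp, {a})" c] by auto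
  qed
  also have "\<dots> = (E a \<star> mono (zero_exp, {b})) c - (E b \<star> mono (zero_exp, {a})) c"
    using ab by (simp add: sum_subtractf)
  finally have "(E a \<star> mono (zero_exp, {b})) c = (E b \<star> mono (zero_exp, {a})) c" by simp
  \<comment> \<open>For odd x the coefficient E_x is even, hence commutes with x_y.\<close>
  moreover have "(E x \<star> mono (zero_exp, {y})) c = (mono (zero_exp, {y}) \<star> E x) c" if "x \<in> I1 r n" for x y
    using Omult_commute [OF centraliser_homog [OF E that] homog_mono] by simp
  ultimately show ?thesis using ab by simp
qed

lemma centraliser_product:
  assumes E: "centralises_J E" and ab: "a \<in> I1 r n" "b \<in> I1 r n"
  shows "(mono (zero_exp, {b}) \<star> E a) c = (mono (zero_exp, {a}) \<star> E b) c"
  using centraliser_product_less [OF E ab] centraliser_product_less [OF E ab(2,1)]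
  by (cases a b rule: linorder_cases) auto

section \<open>Coefficients in the exterior algebra: at most one index is missing\<close>

lemma centraliser_product_coeff:
  assumes E: "centralises_J E" and ab: "a \<in> I1 r n" "b \<in> I1 r n" and v: "v \<subseteq> I1 r n"
  shows "(if b \<in> v then ins_sgn b (v - {b}) * E a (zero_exp, v - {b}) else 0) =
    (if a \<in> v then ins_sgn a (v - {a}) * E b (zero_exp, v - {a}) else 0)"
  using centraliser_product [OF E ab, of "(zero_exp, v)"] v
  by (simp add: Omult_generator ab Basis_iff zero_exp_Aset)

text \<open>Compare coefficients at w with b added: the other side would need x_a, which is
  absent.\<close>

lemma centraliser_missing:
  assumes E: "centralises_J E" and ab: "a \<in> I1 r n" "b \<in> I1 r n" "a \<noteq> b"
    and w: "w \<subseteq> I1 r n" "a \<notin> w" "b \<notin> w"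
  shows "E a (zero_exp, w) = 0"
  using centraliser_product_coeff [OF E ab(1,2), of "insert b w"] ab w by simp

text \<open>Compare coefficients at y with a and b added. Exactly one of a < b and b < a holds, so
  exactly one of the two insertion signs acquires a -1.\<close>

lemma centraliser_exchange:
  assumes E: "centralises_J E" and ab: "a \<in> I1 r n" "b \<in> I1 r n" "a \<noteq> b"
    and y: "y \<subseteq> I1 r n" "a \<notin> y" "b \<notin> y"
  shows "ins_sgn a y * E a (zero_exp, insert a y) = - (ins_sgn b y * E b (zero_exp, insert b y))"
proof -
  have fin: "finite y" using y(1) finite_subset by fastforce
  have s: "insert a (insert b y) - {b} = insert a y" "insert a (insert b y) - {a} = insert b y"
    using ab y by auto
  have "ins_sgn b (insert a y) * E a (zero_exp, insert a y) = ins_sgn a (insert b y) * E b (zero_exp, insert b y)"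
    using centraliser_product_coeff [OF E ab(1,2), of "insert a (insert b y)"] ab y s by simp
  then have *: "ins_sgn b y * E a (zero_exp, insert a y) = - (ins_sgn a y * E b (zero_exp, insert b y))"
    using ab(3) fin y by (auto simp: ins_sgn_insert minus_equation_iff split: if_splits)
  have "ins_sgn a y * E a (zero_exp, insert a y) =
      ins_sgn b y * (ins_sgn a y * (ins_sgn b y * E a (zero_exp, insert a y)))"
    by (simp add: mult.left_commute)
  also have "\<dots> = - (ins_sgn b y * E b (zero_exp, insert b y))"
    unfolding * by simp
  finally show ?thesis .
qed

text \<open>The signed coefficient \<open>?P\<close> changes sign under each exchange; three
  exchanges around a, b, c return it to its start with the sign -1.\<close>

lemma centraliser_two_missing:
  assumes E: "centralises_J E" and abc: "a \<in> I1 r n" "b \<in> I1 r n" "c \<in> I1 r n" "a \<noteq> b" "a \<noteq> c" "b \<noteq> c"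
    and w: "w \<subseteq> I1 r n" "a \<in> w" "b \<notin> w" "c \<notin> w"
  shows "E a (zero_exp, w) = 0"
proof -
  define y where "y = w - {a}"
  have y: "y \<subseteq> I1 r n" "a \<notin> y" "b \<notin> y" "c \<notin> y" "insert a y = w" using w by (auto simp: y_def)
  let ?P = "\<lambda>a. ins_sgn a y * E a (zero_exp, insert a y)"
  have "?P a = - ?P b" "?P b = - ?P c" "?P c = - ?P a"
    using centraliser_exchange [OF E] abc y by metis+
  then have "?P a = - ?P a" by simp
  then have "?P a = 0" by (rule eq_minus_self_zero)
  then show ?thesis using y by simp
qed

section \<open>Rotations and torus weights\<close>

lemma centraliser_rotation_less:
  assumes E: "centralises_J E" and ab: "a \<in> I1 r n" "b \<in> I1 r n" "a < b" and k: "k \<in> I1 r n"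
    and c: "c \<in> BB"
  shows "(mono (zero_exp, {b}) \<star> dd (primeI r n a) (E k)) c - (mono (zero_exp, {a}) \<star> dd (primeI r n b) (E k)) c =
    (if k = primeI r n a then E b c else 0) - (if k = primeI r n b then E a c else 0)"
proof -
  \<comment> \<open>D_H(x_a x_b) is the rotation x_b d_a' - x_a d_b', and E maps its two
    coefficients x_b and -x_a to E_b and -E_a.\<close>
  let ?a = "(zero_exp, {a, b}) :: bidx"
  have sub: "{a, b} \<subseteq> I1 r n" using ab by simp
  have a: "?a \<in> genJ p r n t" using ab by (intro genJ_I [OF zero_exp_Aset one_mem_I0]) auto
  have kI: "k \<in> Iall r n" and k': "primeI r n k \<in> I1 r n" using k primeI_I1 by (auto simp: Iall_def)
  note d0 = dpart_zero_exp [OF sub]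
  note d1 = dpart_pair [OF zero_exp_Aset ab]
  have neg: "(\<lambda>c. - f c) \<star> g = (\<lambda>c. - (f \<star> g) c)" "f \<star> (\<lambda>c. - g c) = (\<lambda>c. - (f \<star> g) c)" for f g
    using Omult_scale_left [of p r n t "-1" f g] Omult_scale_right [of p r n t f "-1" g] by auto
  have "(\<Sum>j\<in>Iall r n. tauI r j * (dd j (mono ?a) \<star> dd (primeI r n j) (E k)) c) =
      (\<Sum>j\<in>I1 r n. (if j = a then (mono (zero_exp, {b}) \<star> dd (primeI r n a) (E k)) c else 0) -
        (if j = b then (mono (zero_exp, {a}) \<star> dd (primeI r n b) (E k)) c else 0))"
    unfolding sum_Iall using ab by (auto simp: d0 d1 tauI_I1 neg intro!: sum.cong)
  also have "\<dots> = (mono (zero_exp, {b}) \<star> dd (primeI r n a) (E k)) c - (mono (zero_exp, {a}) \<star> dd (primeI r n b) (E k)) c"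
    using ab by (simp add: sum_subtractf)
  finally have L: "(\<Sum>j\<in>Iall r n. tauI r j * (dd j (mono ?a) \<star> dd (primeI r n j) (E k)) c) = \<dots>" .
  have g: "(\<Sum>j\<in>Iall r n. (E j \<star> dd j (mono (zero_exp, {x}))) c) = E x c" if x: "x \<in> I1 r n" for x
  proof -
    have xI: "x \<in> Iall r n" using x by (simp add: Iall_def)
    have "(\<Sum>j\<in>Iall r n. (E j \<star> dd j (mono (zero_exp, {x}))) c) = (E x \<star> dd x (mono (zero_exp, {x}))) c"
      by (rule sum_single) (use xI x in \<open>simp_all add: dpart_generator\<close>)
    then show ?thesis using xI x c by (simp add: dpart_generator Omult_one_right)
  qed
  have neg2: "dd j (\<lambda>c. - f c) = (\<lambda>c. - dd j f c)" for j f
    using dpart_scale [of p r n t j "-1" f] by auto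
  have da: "dd a (mono ?a) = mono (zero_exp, {b})" and db: "dd b (mono ?a) = (\<lambda>c. - mono (zero_exp, {a}) c)"
    using ab by (simp_all add: d1)
  have "tauI r (primeI r n k) * (\<Sum>j\<in>Iall r n. (E j \<star> dd j (dd (primeI r n k) (mono ?a))) c) =
      (if k = primeI r n a then E b c else 0) - (if k = primeI r n b then E a c else 0)"
  proof -
    consider "primeI r n k = a" | "primeI r n k = b" | "primeI r n k \<noteq> a" "primeI r n k \<noteq> b" by blast
    then show ?thesis
    proof cases
      case 1
      with ab have "k = primeI r n a" "k \<noteq> primeI r n b" by auto
      then show ?thesis unfolding 1 da g [OF ab(2)] using ab by (simp add: tauI_I1)
    next
      case 2
      with ab have "k = primeI r n b" "k \<noteq> primeI r n a" by auto
      then show ?thesis unfolding 2 db neg2 neg sum_negf g [OF ab(1)] using ab by (simp add: tauI_I1)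
    next
      case 3
      then have "k \<noteq> primeI r n a" "k \<noteq> primeI r n b" by auto
      with 3 show ?thesis by (simp add: d1 [OF k'])
    qed
  qed
  then show ?thesis using centraliser_eq [OF E a kI, of c] L by simp
qed

lemma centraliser_rotation:
  assumes E: "centralises_J E" and ab: "a \<in> I1 r n" "b \<in> I1 r n" "a \<noteq> b" and k: "k \<in> I1 r n"
    and c: "c \<in> BB"
  shows "(mono (zero_exp, {b}) \<star> dd (primeI r n a) (E k)) c - (mono (zero_exp, {a}) \<star> dd (primeI r n b) (E k)) c =
    (if k = primeI r n a then E b c else 0) - (if k = primeI r n b then E a c else 0)"
proof (cases "a < b")
  case True
  then show ?thesis using centraliser_rotation_less [OF E ab(1,2) _ k c] by simp
next
  case False
  then show ?thesis using centraliser_rotation_less [OF E ab(2,1) _ k c] ab(3)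
    by (simp add: algebra_simps split: if_splits)
qed

text \<open>The element \<open>D\<^sub>H(x\<^sub>a x\<^bsub>a'\<^esub>)\<close> acts diagonally, so each monomial of \<open>E\<close> has weight zero; as \<open>p > 3\<close>, the weight condition can be read in the integers.\<close>

lemma centraliser_weight:
  assumes E: "centralises_J E" and a: "a \<in> I1 r n" "b = primeI r n a" "a \<noteq> b" and k: "k \<in> I1 r n"
    and nz: "E k (zero_exp, v) \<noteq> 0"
  shows "of_bool (b \<in> v) + of_bool (k = a) = (of_bool (a \<in> v) + of_bool (k = b) :: nat)"
proof -
  have b: "b \<in> I1 r n" "primeI r n b = a" using a primeI_I1 by auto
  have mem: "(zero_exp, v) \<in> BB" using E nz W1_outside unfolding centralises_J_def by blast
  \<comment> \<open>The operator x_x d_x fixes the monomials containing x_x, the two signs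
    cancelling, and kills the others.\<close>
  have sq: "(mono (zero_exp, {x}) \<star> dd x (E k)) (zero_exp, v) = (if x \<in> v then E k (zero_exp, v) else 0)"
    if "x \<in> I1 r n" for x
    using that mem by (auto simp: Omult_generator dpart_I1 insert_absorb Basis_iff)
  have "(if b \<in> v then E k (zero_exp, v) else 0) - (if a \<in> v then E k (zero_exp, v) else 0) =
    (if k = b then E b (zero_exp, v) else 0) - (if k = a then E a (zero_exp, v) else 0)"
    using centraliser_rotation [OF E a(1) b(1) a(3) k mem] sq a b by simp
  then have "((of_bool (b \<in> v) + of_bool (k = a)) - (of_bool (a \<in> v) + of_bool (k = b))) * E k (zero_exp, v) = 0"
    by (auto simp: algebra_simps split: if_splits)
  then have "(of_bool (b \<in> v) + of_bool (k = a) :: 'a) = of_bool (a \<in> v) + of_bool (k = b)"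
    using nz by simp
  moreover have "(2 :: 'a) \<noteq> 1" by (metis add_cancel_right_right one_add_one zero_neq_one)
  ultimately show ?thesis using two_nonzero by (auto simp: of_bool_def split: if_splits)
qed

text \<open>Not more than one index is missing from v; weights and parity exclude v = I_1, and
  weights identify the missing index as k'. Since |v| = n - 1 is even, n is odd.\<close>

lemma centraliser_support:
  assumes E: "centralises_J E" and k: "k \<in> I1 r n" and nz: "E k (zero_exp, v) \<noteq> 0"
  shows "odd n" "v = I1 r n - {primeI r n k}"
proof -
  have "(zero_exp, v) \<in> BB" using E nz W1_outside unfolding centralises_J_def by blast
  then have v: "v \<subseteq> I1 r n" by (simp add: Basis_iff)
  have ev: "even (card v)" using homog_parity [OF centraliser_homog [OF E k] nz] by simp
  have cI: "card (I1 r n) = n" by (simp add: I1_def)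
  have one_missing: "odd n" if "v = I1 r n - {b}" "b \<in> I1 r n" for b
    using ev that cI n_pos by (simp add: card_Diff_singleton)
  have uniq: "b = c" if "b \<in> I1 r n - v" "c \<in> I1 r n - v" for b c
  proof (rule ccontr)
    \<comment> \<open>If k lies in v, the case of two missing indices applies; otherwise k itself is
      missing, together with whichever of b, c differs from it.\<close>
    assume "b \<noteq> c"
    then show False
      using nz centraliser_missing [OF E k, of b v] centraliser_missing [OF E k, of c v]
        centraliser_two_missing [OF E k, of b c v] that v by blast
  qed
  have weight: "of_bool (primeI r n a \<in> v) + of_bool (k = a) = (of_bool (a \<in> v) + of_bool (k = primeI r n a) :: nat)"
    if "a \<in> I1 r n" "a \<noteq> primeI r n a" for a
    using centraliser_weight [OF E that(1) refl that(2) k nz] .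
  have "v \<noteq> I1 r n"
  proof
    \<comment> \<open>For k = k' the number n would be odd, yet |v| = n is even; for k different
      from k' the weight equation at k reads 1 + 1 = 1 + 0.\<close>
    assume all: "v = I1 r n"
    show False
    proof (cases "primeI r n k = k")
      case True
      then show False using primeI_fixed_I1(1) [OF k] ev all cI by simp
    next
      case False
      then show False using weight [OF k] k primeI_I1 [OF k] by (simp add: all)
    qed
  qed
  then obtain b where b: "b \<in> I1 r n" "b \<notin> v" using v by blast
  then have vb: "v = I1 r n - {b}" using uniq v by blast
  then show "odd n" using one_missing b by blast
  have "b = primeI r n k"
  proof (rule ccontr)
    assume ne: "b \<noteq> primeI r n k"
    then have ne': "k \<noteq> primeI r n b" by auto
    show False
    \<comment> \<open>If b is paired, the weight equation at b has a positive left side and right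
      side 0. If b is the unpaired index, then k is paired, and at k the left side is 2 while the
      right side is at most 1.\<close>
    proof (cases "primeI r n b = b")
      case False
      then show False using weight [OF b(1)] ne' b primeI_I1 [OF b(1)] by (simp add: vb)
    next
      case True
      have "primeI r n k \<noteq> k" using primeI_fixed_I1(2) [OF b(1) True] primeI_fixed_I1(2) [OF k] ne by metis
      then show False using weight [OF k] ne ne' True k primeI_I1 [OF k] by (simp add: vb)
    qed
  qed
  then show "v = I1 r n - {primeI r n k}" using vb by simp
qed

section \<open>The centraliser for even and for odd n\<close>

lemma centraliser_even:
  assumes E: "centralises_J E" and "even n" shows "E = (\<lambda>k c. 0)"
proof (intro ext)
  fix k c show "E k c = 0"
  proof (rule ccontr)
    assume nz: "E k c \<noteq> 0"
    obtain \<gamma> v where c: "c = (\<gamma>, v)" by (cases c)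
    have "k \<in> I1 r n" using centraliser_index [OF E nz] .
    moreover have "\<gamma> = zero_exp" using centraliser_constant [OF E] nz c by blast
    ultimately show False using centraliser_support(1) [OF E] nz c \<open>even n\<close> by blast
  qed
qed

lemma DHm_omega:
  "DHm p r n t (zero_exp, omega r n) k c =
    (if k \<in> I1 r n then (-1) ^ n * ins_sgn (primeI r n k) (I1 r n) * mono (zero_exp, I1 r n - {primeI r n k}) c else (0 :: 'a))"
proof -
  have sub: "omega r n \<subseteq> I1 r n" "card (omega r n) = n" by (simp_all add: omega_def I1_def)
  have "dd (primeI r n k) (mono (zero_exp, omega r n)) c =
      (if k \<in> I1 r n then ins_sgn (primeI r n k) (I1 r n) * mono (zero_exp, I1 r n - {primeI r n k}) c else 0)"
    if "k \<in> Iall r n"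
  proof (cases "k \<in> I1 r n")
    case True
    then have k': "primeI r n k \<in> I1 r n" by simp
    have "dd (primeI r n k) (mono (zero_exp, omega r n)) c = dpart_basis r n (primeI r n k) (zero_exp, omega r n) c"
      by (rule dpart_mono) simp
    then show ?thesis using k' True by (simp add: dpart_basis_I1 omega_def)
  next
    case False
    then have "primeI r n k \<in> I0 r" using that primeI_I0 by (auto simp: Iall_def)
    then show ?thesis using False dpart_zero_exp [OF sub(1)] by simp
  qed
  then show ?thesis
    using tauI_I1 [of "primeI r n k" r n] by (auto simp: DHm_def DH_eq sub muI_def Iall_def)
qed

text \<open>Each E_k has at most one coefficient, at omega without k'. Rotations D_H(x_c x_z)
  through the unpaired index z tie all of these to the one of E_z, in the same ratios as in
  D_H(x^omega).\<close>

lemma centraliser_odd: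
  assumes E: "centralises_J E" and "odd n"
  shows "\<exists>\<mu>. E = (\<lambda>k c. \<mu> * DHm p r n t (zero_exp, omega r n) k c)"
proof -
  define z where "z = 2*r + n"
  have z: "z \<in> I1 r n" "primeI r n z = z"
    using primeI_last [OF \<open>odd n\<close> r_pos] n_pos by (auto simp: z_def I1_def)
  let ?S = "I1 r n"
  \<comment> \<open>Read off from the component z of D_H(x^omega): the minus sign is (-1)^n, and the
    insertion sign is its own inverse.\<close>
  define \<mu> where "\<mu> = - (ins_sgn z ?S * E z (zero_exp, ?S - {z}))"
  have coeff: "E k (zero_exp, ?S - {primeI r n k}) = - (\<mu> * ins_sgn (primeI r n k) ?S)" if k: "k \<in> ?S" for k
  proof (cases "k = z")
    case True
    then show ?thesis using z by (simp add: \<mu>_def mult_ac)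
  next
    case False
    define c where "c = primeI r n k"
    have c: "c \<in> ?S" "primeI r n c = k" "c \<noteq> z" using k False z primeI_I1 by (auto simp: c_def)
    define y where "y = ?S - {z} - {c}"
    have y: "?S = insert z (insert c y)" "z \<notin> y" "c \<notin> y" "finite y" using c z by (auto simp: y_def)
    have yz: "insert z y = ?S - {c}" using c z by (auto simp: y_def)
    have mem: "(zero_exp, ?S - {z}) \<in> BB" "(zero_exp, ?S - {c}) \<in> BB" by (auto simp: Basis_iff zero_exp_Aset)
    \<comment> \<open>Component k of the rotation with c = k', at the monomial omega without z: the
      term with x_z vanishes there, and this one recovers the coefficient of E_k at omega without
      c.\<close>
    have "(mono (zero_exp, {c}) \<star> dd z (E k)) (zero_exp, ?S - {z}) =
        ins_sgn c y * (ins_sgn z y * E k (zero_exp, ?S - {c}))"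
      using c z mem y(2) yz by (simp add: Omult_generator dpart_I1 flip: y_def)
    moreover have "(mono (zero_exp, {z}) \<star> dd k (E k)) (zero_exp, ?S - {z}) = 0"
      using z by (simp add: Omult_generator)
    ultimately have *: "- (ins_sgn c y * (ins_sgn z y * E k (zero_exp, ?S - {c}))) = E z (zero_exp, ?S - {z})"
      using centraliser_rotation [OF E c(1) z(1) c(3) k mem(1)] c z False by simp
    have sz: "ins_sgn z ?S = (if c < z then -1 else 1) * ins_sgn z y"
      "ins_sgn c ?S = (if z < c then -1 else 1) * (ins_sgn c y :: 'a)"
      using y c(3) by (simp_all add: ins_sgn_insert_self ins_sgn_insert insert_commute [of z c])
    have "E k (zero_exp, ?S - {c}) = ins_sgn z ?S * (ins_sgn c ?S * E z (zero_exp, ?S - {z}))"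
      unfolding * [symmetric] sz using c(3) by (simp add: mult.left_commute [of "ins_sgn c y" "ins_sgn z y"])
    then show ?thesis by (simp add: \<mu>_def mult_ac flip: c_def)
  qed
  have "E k c = \<mu> * DHm p r n t (zero_exp, omega r n) k c" for k c
  proof -
    obtain \<gamma> v where c: "c = (\<gamma>, v)" by (cases c)
    show ?thesis
    proof (cases "k \<in> ?S \<and> \<gamma> = zero_exp \<and> v = ?S - {primeI r n k}")
      case True
      then show ?thesis using coeff \<open>odd n\<close> by (simp add: c DHm_omega mono_def)
    next
      case False
      have "E k c = 0"
      proof (rule ccontr)
        assume nz: "E k c \<noteq> 0"
        have "k \<in> I1 r n" using centraliser_index [OF E nz] .
        moreover have "\<gamma> = zero_exp" using centraliser_constant [OF E] nz c by blast
        ultimately show False using centraliser_support(2) [OF E] nz c False by blast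
      qed
      moreover have "DHm p r n t (zero_exp, omega r n) k c = (0 :: 'a)"
        using False by (auto simp: c DHm_omega mono_def)
      ultimately show ?thesis by simp
    qed
  qed
  then show ?thesis by blast
qed

end

section \<open>Derivations vanishing on the ideal\<close>

lemma DHm_even: "even (card (snd a)) \<Longrightarrow> DHm p r n t a = DH p r n t 0 (mono a)"
  by (intro ext) (simp add: DHm_def DH_eq minus_one_power_iff)

lemma DH_zero: "DH p r n t q (\<lambda>c. 0) k c = 0"
  by (simp add: DH_eq)

text \<open>All generators have even parity, so D_H is linear on their span, and a combination of
  generators is D_H of one function supported on S.\<close>

lemma sum_DHm:
  assumes "S \<subseteq> Aset p r t \<times> B0set r n"
  shows "(\<lambda>k c. \<Sum>a\<in>S. lam a * DHm p r n t a k c) = DH p r n t 0 (\<lambda>a. if a \<in> S then lam a else 0)"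
proof (intro ext)
  fix k c
  have S: "S \<subseteq> Basis p r n t" using assms by (auto simp: Basis_def B0set_def)
  have "(\<Sum>a\<in>S. lam a * DHm p r n t a k c) = (\<Sum>a\<in>S. lam a * DH p r n t 0 (mono a) k c)"
    using assms by (intro sum.cong refl) (subst DHm_even, auto simp: B0set_def)
  also have "\<dots> = (\<Sum>a\<in>Basis p r n t. (if a \<in> S then lam a else 0) * DH p r n t 0 (mono a) k c)"
    using S by (intro sum.mono_neutral_cong_left) auto
  also have "\<dots> = DH p r n t 0 (\<lambda>a. if a \<in> S then lam a else 0) k c"
    by (simp add: DH_eq dpart_expand [of _ _ _ _ _ "\<lambda>a. if a \<in> S then lam a else 0"] sum_distrib_left mult.left_commute)
  finally show "(\<Sum>a\<in>S. lam a * DHm p r n t a k c) = DH p r n t 0 (\<lambda>a. if a \<in> S then lam a else 0) k c" .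
qed

lemma span_DHm_iff:
  assumes "S \<subseteq> Aset p r t \<times> B0set r n"
  shows "x \<in> {(\<lambda>k c. \<Sum>a\<in>S. lam a * DHm p r n t a k c) | lam. True} \<longleftrightarrow>
    (\<exists>f. (\<forall>a. f a \<noteq> 0 \<longrightarrow> a \<in> S) \<and> x = DH p r n t 0 f)"
proof
  assume "x \<in> {(\<lambda>k c. \<Sum>a\<in>S. lam a * DHm p r n t a k c) | lam. True}"
  then obtain lam where "x = DH p r n t 0 (\<lambda>a. if a \<in> S then lam a else 0)"
    unfolding mem_Collect_eq sum_DHm [OF assms] by blast
  then show "\<exists>f. (\<forall>a. f a \<noteq> 0 \<longrightarrow> a \<in> S) \<and> x = DH p r n t 0 f"
    by (intro exI [of _ "\<lambda>a. if a \<in> S then lam a else 0"]) simp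
next
  assume "\<exists>f. (\<forall>a. f a \<noteq> 0 \<longrightarrow> a \<in> S) \<and> x = DH p r n t 0 f"
  then obtain f where f: "\<forall>a. f a \<noteq> 0 \<longrightarrow> a \<in> S" and x: "x = DH p r n t 0 f" by blast
  have "f = (\<lambda>a. if a \<in> S then f a else 0)" using f by (intro ext) auto
  then have "x = DH p r n t 0 (\<lambda>a. if a \<in> S then f a else 0)" using x by simp
  then show "x \<in> {(\<lambda>k c. \<Sum>a\<in>S. lam a * DHm p r n t a k c) | lam. True}"
    unfolding mem_Collect_eq sum_DHm [OF assms] by (intro exI [of _ f]) simp
qed

lemma H0_iff: "x \<in> H0 p r n t \<longleftrightarrow> (\<exists>f. (\<forall>a. f a \<noteq> 0 \<longrightarrow> a \<in> genH p r n t) \<and> x = DH p r n t 0 f)"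
  unfolding H0_def by (rule span_DHm_iff) (auto simp: genH_def)

lemma Jid_iff: "x \<in> Jid p r n t \<longleftrightarrow> (\<exists>f. (\<forall>a. f a \<noteq> 0 \<longrightarrow> a \<in> genJ p r n t) \<and> x = DH p r n t 0 f)"
  unfolding Jid_def by (rule span_DHm_iff) (auto simp: genJ_def genH_def)

lemma Jid_subset_H0: "Jid p r n t \<subseteq> H0 p r n t"
  unfolding subset_iff H0_iff Jid_iff genJ_def by blast

lemma brW_scale_left: "brW p r n t (\<lambda>k c. s * D k c) E k c = s * brW p r n t D E k c"
  by (simp add: brW_def sum_distrib_left mult.assoc)

lemma brW_scale_right: "brW p r n t D (\<lambda>k c. s * E k c) k c = s * brW p r n t D E k c"
  by (simp add: brW_def sum_distrib_left mult_ac)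

lemma brW_zero_left: "brW p r n t (\<lambda>k c. 0) E k c = 0"
  by (simp add: brW_def)

lemma homog_genH: "(\<And>a. f a \<noteq> 0 \<Longrightarrow> a \<in> genH p r n t) \<Longrightarrow> homog 0 f"
  unfolding homog_def genH_def B0set_def by fastforce

context ham
begin

section \<open>Brackets lying in J and the decomposition of H\<close>

abbreviation DH_pi :: "'a Wel" where "DH_pi \<equiv> DHm p r n t (pie, {})"
abbreviation DH_omega :: "'a Wel" where "DH_omega \<equiv> DHm p r n t (zero_exp, omega r n)"

lemma pb_support:
  assumes f: "homog 0 f" and g: "homog 0 g" and nz: "pb f g a \<noteq> 0"
  shows "a \<in> genJ p r n t"
proof -
  have "a \<in> BB"
  proof (rule ccontr)
    assume "a \<notin> BB"
    then have "pb f g a = 0" unfolding pb_def by (simp add: Omult_outside_Basis)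
    then show False using nz by simp
  qed
  moreover have "even (card (snd a))" using homog_parity [OF homog_pb [OF f g] nz] by simp
  moreover have "a \<noteq> (pie, omega r n)" "a \<noteq> (pie, {})"
    using nz pb_pi_omega [OF f, of g] pb_pi_empty [OF f, of g] by auto
  ultimately show ?thesis by (cases a) (auto simp: genJ_def genH_def B0set_def Basis_def)
qed

text \<open>The bracket is D_H of a Poisson bracket of even functions, in which neither x^pi x^omega
  nor x^pi occurs.\<close>

lemma brW_H0_in_Jid:
  assumes "x \<in> H0 p r n t" "y \<in> H0 p r n t"
  shows "brW p r n t x (y :: 'a Wel) \<in> Jid p r n t"
proof -
  obtain f g where f: "homog 0 f" "x = DH p r n t 0 f" and g: "homog 0 g" "y = DH p r n t 0 g"
    using assms unfolding H0_iff by (metis homog_genH)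
  then have "brW p r n t x y = DH p r n t 0 (pb f g)" using brW_DH by simp
  then show ?thesis unfolding Jid_iff using pb_support [OF f(1) g(1)] by blast
qed

lemma DH_mono_in_Jid:
  "a \<in> genJ p r n t \<Longrightarrow> DH p r n t 0 (mono a) \<in> Jid p r n t"
  unfolding Jid_iff by (rule exI [of _ "mono a"]) (simp add: mono_def)

lemma DH_pi_eq: "DH_pi = DH p r n t 0 (mono (pie, {}))"
  by (rule DHm_even) simp

lemma DH_pi_in_H0: "DH_pi \<in> H0 p r n t"
proof -
  have "omega r n \<noteq> {}" using n_pos by (simp add: omega_def I1_def)
  then have "(pie, {}) \<in> genH p r n t"
    by (auto simp: genH_def Aset_def B0set_def Bset_def)
  then show ?thesis unfolding H0_iff DH_pi_eq by (intro exI [of _ "mono (pie, {})"]) (simp add: mono_def)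
qed

text \<open>The term at x^pi is split off from a function that generates x.\<close>

lemma H0_decompose:
  assumes "x \<in> H0 p r n t"
  obtains y and s :: 'a where "y \<in> Jid p r n t" "x = (\<lambda>k c. y k c + s * DH_pi k c)"
proof -
  obtain f where f: "\<And>a. f a \<noteq> 0 \<Longrightarrow> a \<in> genH p r n t" and x: "x = DH p r n t 0 f"
    using assms unfolding H0_iff by blast
  let ?g = "f((pie, {}) := 0)" and ?s = "f (pie, {})"
  have "DH p r n t 0 ?g \<in> Jid p r n t"
    unfolding Jid_iff using f by (intro exI [of _ ?g]) (auto simp: genJ_def)
  moreover have "dd j f c = dd j ?g c + ?s * dd j (mono (pie, {})) c" for j c
  proof -
    have "f = (\<lambda>c. ?g c + ?s * mono (pie, {}) c)" by (auto simp: mono_def)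
    then have "dd j f c = dd j (\<lambda>c. ?g c + ?s * mono (pie, {}) c) c"
      by (rule arg_cong [where f = "\<lambda>h. dd j h c"])
    then show ?thesis by (simp only: dpart_add dpart_scale)
  qed
  then have "x = (\<lambda>k c. DH p r n t 0 ?g k c + ?s * DH_pi k c)"
    unfolding x DH_pi_eq by (intro ext) (simp add: DH_eq algebra_simps)
  ultimately show thesis by (rule that)
qed

lemma linear_vanishing_on_J:
  assumes add: "\<And>x y. x \<in> H0 p r n t \<Longrightarrow> y \<in> H0 p r n t \<Longrightarrow> \<phi> (\<lambda>k c. x k c + y k c) = (\<lambda>k c. \<phi> x k c + \<phi> y k c)"
    and scale: "\<And>x s. x \<in> H0 p r n t \<Longrightarrow> \<phi> (\<lambda>k c. s * x k c) = (\<lambda>k c. s * \<phi> x k c)"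
    and J: "\<And>x. x \<in> Jid p r n t \<Longrightarrow> \<phi> x = (\<lambda>k c. 0)"
    and x: "x \<in> H0 p r n t"
  obtains s :: 'a where "(\<phi> :: 'a Wel \<Rightarrow> 'a Wel) x = (\<lambda>k c. s * \<phi> DH_pi k c)"
proof -
  obtain y and s :: 'a where y: "y \<in> Jid p r n t" and xy: "x = (\<lambda>k c. y k c + s * DH_pi k c)"
    using H0_decompose [OF x] .
  \<comment> \<open>Additivity is available on H only, so the multiple of D_H(x^pi) must be shown to
    lie there.\<close>
  have "(\<lambda>k c. s * DH_pi k c) \<in> H0 p r n t"
  proof -
    have "(\<lambda>k c. s * DH_pi k c) = DH p r n t 0 (\<lambda>c. s * mono (pie, {}) c)"
      unfolding DH_pi_eq by (intro ext) (simp add: DH_eq dpart_scale)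
    moreover have "(pie, {}) \<in> genH p r n t"
      using n_pos by (auto simp: genH_def Aset_def B0set_def Bset_def omega_def I1_def)
    ultimately show ?thesis unfolding H0_iff
      by (intro exI [of _ "\<lambda>c. s * mono (pie, {}) c"]) (simp add: mono_def)
  qed
  moreover have "y \<in> H0 p r n t" using y Jid_subset_H0 by blast
  ultimately have "\<phi> x = (\<lambda>k c. \<phi> y k c + \<phi> (\<lambda>k c. s * DH_pi k c) k c)"
    unfolding xy by (intro add)
  then have "\<phi> x = (\<lambda>k c. s * \<phi> DH_pi k c)"
    by (simp add: scale [OF DH_pi_in_H0] J [OF y])
  then show thesis by (rule that)
qed

text \<open>For x in J the derivation rule on [x, D_H(x^pi)] leaves only [x, E], because both the
  bracket and x lie in J, where the map vanishes.\<close>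

lemma derivation_centralises_J:
  assumes d: "is_derivation p r n t \<phi>" and J: "\<And>x. x \<in> Jid p r n t \<Longrightarrow> \<phi> x = (\<lambda>k c. 0)"
  shows "centralises_J (\<phi> DH_pi)"
  unfolding centralises_J_def
proof
  show "\<phi> DH_pi \<in> W1 p r n t" using d DH_pi_in_H0 by (simp add: is_derivation_def)
  show "\<forall>a\<in>genJ p r n t. brW p r n t (DH p r n t 0 (mono a)) (\<phi> DH_pi) = (\<lambda>k c. 0)"
  proof
    fix a assume "a \<in> genJ p r n t"
    then have x: "DH p r n t 0 (mono a) \<in> Jid p r n t" (is "?x \<in> _") by (rule DH_mono_in_Jid)
    then have H: "?x \<in> H0 p r n t" using Jid_subset_H0 by blast
    have "\<phi> (brW p r n t ?x DH_pi) =
        (\<lambda>k c. brW p r n t (\<phi> ?x) DH_pi k c + brW p r n t ?x (\<phi> DH_pi) k c)"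
      using d H DH_pi_in_H0 unfolding is_derivation_def by blast
    then show "brW p r n t ?x (\<phi> DH_pi) = (\<lambda>k c. 0)"
      using J [OF x] J [OF brW_H0_in_Jid [OF H DH_pi_in_H0]] by (simp add: brW_zero_left)
  qed
qed

section \<open>The converse: derivations with values in the multiples of D_H(x^omega)\<close>

lemma DH_omega_in_W1:
  assumes "odd n" shows "DH_omega \<in> W1 p r n t"
proof -
  have "even (card (I1 r n - {primeI r n k}))" if "k \<in> I1 r n" for k
    using that assms by (simp add: card_Diff_singleton) (simp add: I1_def)
  then show ?thesis
    by (auto simp: W1_def DHm_omega mono_def Iall_def Basis_iff zero_exp_Aset muI_def split: if_splits)
qed

lemma brW_DH_omega:
  assumes "x \<in> H0 p r n t"
  shows "brW p r n t x DH_omega k c = 0" "brW p r n t DH_omega x k c = 0"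
proof -
  obtain f where f: "homog 0 f" "x = DH p r n t 0 f"
    using assms unfolding H0_iff by (metis homog_genH)
  have "brW p r n t x DH_omega = DH p r n t (card (omega r n)) (pb f (mono (zero_exp, omega r n)))"
    using brW_DH [OF f(1) homog_mono, of "(zero_exp, omega r n)"] by (simp add: f(2) DHm_def)
  then have z: "brW p r n t x DH_omega k c = 0"
    unfolding pb_omega [OF f(1), abs_def] by (simp add: DH_zero)
  then show "brW p r n t x DH_omega k c = 0" .
  show "brW p r n t DH_omega x k c = 0"
  proof (cases "k \<in> Iall r n")
    case True
    \<comment> \<open>With one even argument the bracket is antisymmetric, so this order follows
      from the first.\<close>
    then show ?thesis using z even_field_DH [OF f(1)] by (simp add: brW_even_field f(2))
  qed (simp add: brW_outside)
qed

text \<open>Both sides of the derivation rule are zero: [x, y] lies in J, and the values are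
  multiples of D_H(x^omega), which commutes with H.\<close>

lemma is_derivation_DH_omega:
  fixes \<Gamma> :: "'a Wel \<Rightarrow> 'a Wel"
  assumes "odd n"
    and add: "\<And>x y. x \<in> H0 p r n t \<Longrightarrow> y \<in> H0 p r n t \<Longrightarrow> \<Gamma> (\<lambda>k c. x k c + y k c) = (\<lambda>k c. \<Gamma> x k c + \<Gamma> y k c)"
    and scale: "\<And>x s. x \<in> H0 p r n t \<Longrightarrow> \<Gamma> (\<lambda>k c. s * x k c) = (\<lambda>k c. s * \<Gamma> x k c)"
    and J: "\<And>x. x \<in> Jid p r n t \<Longrightarrow> \<Gamma> x = (\<lambda>k c. 0)"
    and pi: "\<Gamma> DH_pi = (\<lambda>k c. \<mu> * DH_omega k c)"
  shows "is_derivation p r n t \<Gamma>"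
proof -
  have multiple: "\<exists>s. \<Gamma> x = (\<lambda>k c. s * DH_omega k c)" if x: "x \<in> H0 p r n t" for x
  proof -
    obtain s where "\<Gamma> x = (\<lambda>k c. s * \<Gamma> DH_pi k c)"
      using linear_vanishing_on_J [where \<phi> = \<Gamma>, OF add scale J x] .
    then have "\<Gamma> x = (\<lambda>k c. (s * \<mu>) * DH_omega k c)" by (simp add: pi mult.assoc)
    then show ?thesis ..
  qed
  have "\<Gamma> x \<in> W1 p r n t" if "x \<in> H0 p r n t" for x
    using multiple [OF that] DH_omega_in_W1 [OF \<open>odd n\<close>] by (auto simp: W1_def)
  moreover have "\<Gamma> (brW p r n t x y) = (\<lambda>k c. brW p r n t (\<Gamma> x) y k c + brW p r n t x (\<Gamma> y) k c)"
    if xy: "x \<in> H0 p r n t" "y \<in> H0 p r n t" for x y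
  proof -
    obtain s s' where "\<Gamma> x = (\<lambda>k c. s * DH_omega k c)" "\<Gamma> y = (\<lambda>k c. s' * DH_omega k c)"
      using multiple [OF xy(1)] multiple [OF xy(2)] by blast
    then show ?thesis
      by (simp add: J [OF brW_H0_in_Jid [OF xy]] brW_scale_left brW_scale_right brW_DH_omega xy)
  qed
  ultimately show ?thesis unfolding is_derivation_def using add scale by blast
qed

end

text \<open>A map from H to the odd part of W is represented by a function on all of
  \<open>'a Wel\<close> that is constrained on \<open>H0\<close> only. The converse therefore ranges
  over every \<open>\<Gamma>\<close> with the prescribed restriction to \<open>H0\<close>.\<close>

theorem theorem3p4:
  fixes p r n :: nat and t :: "nat \<Rightarrow> nat"
    and \<phi> :: "'a::alg_closed_field Wel \<Rightarrow> 'a Wel"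
  assumes "prime p" and "p > 3" and "CHAR('a) = p"
    and "r > 0" and "n > 0" and "\<forall>i\<in>I0 r. t i > 0"
    and "is_derivation p r n t \<phi>"
    and "\<forall>x\<in>Jid p r n t. \<phi> x = (\<lambda>k c. 0)"
  shows "(even n \<longrightarrow> (\<forall>x\<in>H0 p r n t. \<phi> x = (\<lambda>k c. 0)))
       \<and> (odd n \<longrightarrow> (\<exists>\<mu>::'a. \<phi> (DHm p r n t (piv p r t, {})) =
                              (\<lambda>k c. \<mu> * DHm p r n t (\<lambda>i. 0, omega r n) k c)))
       \<and> (odd n \<longrightarrow> (\<forall>(\<mu>::'a) (\<Gamma>::'a Wel \<Rightarrow> 'a Wel).
              (\<forall>x\<in>H0 p r n t. \<forall>y\<in>H0 p r n t. \<Gamma> (\<lambda>k c. x k c + y k c) = (\<lambda>k c. \<Gamma> x k c + \<Gamma> y k c))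
            \<and> (\<forall>x\<in>H0 p r n t. \<forall>s. \<Gamma> (\<lambda>k c. s * x k c) = (\<lambda>k c. s * \<Gamma> x k c))
            \<and> (\<forall>x\<in>Jid p r n t. \<Gamma> x = (\<lambda>k c. 0))
            \<and> \<Gamma> (DHm p r n t (piv p r t, {})) = (\<lambda>k c. \<mu> * DHm p r n t (\<lambda>i. 0, omega r n) k c)
            \<longrightarrow> is_derivation p r n t \<Gamma>))"
proof -
  interpret ham p r n t "TYPE('a)"
    using assms by unfold_locales auto
  have cent: "centralises_J (\<phi> DH_pi)"
    using assms(7,8) by (intro derivation_centralises_J) auto
  have "\<phi> x = (\<lambda>k c. 0)" if "even n" and x: "x \<in> H0 p r n t" for x
  proof -
    obtain s where "\<phi> x = (\<lambda>k c. s * \<phi> DH_pi k c)"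
      by (rule linear_vanishing_on_J [where \<phi> = \<phi>, OF _ _ _ x])
        (use assms(7,8) in \<open>auto simp: is_derivation_def\<close>)
    then show ?thesis using centraliser_even [OF cent \<open>even n\<close>] by simp
  qed
  moreover have "\<exists>\<mu>. \<phi> DH_pi = (\<lambda>k c. \<mu> * DH_omega k c)" if "odd n"
    using centraliser_odd [OF cent that] .
  ultimately show ?thesis
    by (intro conjI impI allI ballI) (auto intro!: is_derivation_DH_omega)
qed

end
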